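(* Let $n\ge2$, $m\ge2$ be integers, let $X_{n,m}=\{p_{n,m}(z;x_1,\dots,x_m)=0\}\subset\mathbb{C}P^m$, and put $$P_{n,m}(w;u_1,\dots,u_m)=(u_1\cdots u_mw)^{(n-1)^{m-1}}\,p_{n-1,m}(w^{-1};u_1^{-1},\dots,u_m^{-1}).$$ Then the projectively dual variety is $X_{n,m}^\vee=\{P_{n,m}=0\}\subset(\mathbb{C}P^m)^\ast$, and the composition of the duality $X_{n,m}\mapsto X_{n,m}^\vee$ with the subsequent Möbius transformation $(u_1,\dots,u_m,w)\mapsto(1/u_1,\dots,1/u_m,1/w)$ defines the shift operation $\mathcal{O}_{n,m}(\mathbb{C}P^1)\mapsto\mathcal{O}_{n-1,m}(\mathbb{C}P^1)$ in the family of $m$-ary $n^{m-1}$-valued algebraic structures $\mathcal{O}_{n,m}(\mathbb{C}P^1)$ (i.e. it takes the defining polynomial $p_{n,m}$ to the defining polynomial $p_{n-1,m}$).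
   Context: For $n\ge1$ and $\varepsilon=e^{2\pi i/n}$, $$p_{n,m}(z;x_1,\dots,x_m)=\prod_{k_1,\dots,k_m=1}^n\bigl(\sqrt[n]{z}+\varepsilon^{k_1}\sqrt[n]{x_1}+\dots+\varepsilon^{k_m}\sqrt[n]{x_m}\bigr)$$ (fixed branches of the roots), a symmetric homogeneous polynomial of degree $n^{m-1}$ in $z,x_1,\dots,x_m$. It defines the $m$-ary $n^{m-1}$-valued algebraic operation $\mu(x_1,\dots,x_m)=[z\mid p_{n,m}(z;x_1,\dots,x_m)=0]$; $\mathcal{O}_{n,m}(\mathbb{C}P^1)$ denotes $\mathbb{C}P^1$ with this (partially defined) operation. $\mathbb{C}P^m$ has homogeneous coordinates $(x_1:\dots:x_m:z)$, and $(u_1:\dots:u_m:w)\in(\mathbb{C}P^m)^\ast$ represents the hyperplane $\sum u_jx_j+wz=0$. The projectively dual variety $X^\vee$ is the closure of the set of hyperplanes tangent to $X$ at its smooth points. *)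

theory Defs
  imports "HOL-Analysis.Analysis" "HOL-Library.Multiset"
begin

section \<open>Polynomial functions in finitely many complex variables\<close>

text \<open>Polynomials are represented by the functions they induce, which over the complex
  numbers determine their coefficients.\<close>

definition polynomial_fun :: "(complex ^ 'v \<Rightarrow> complex) \<Rightarrow> bool" where
  "polynomial_fun f \<longleftrightarrow> (\<exists>(A :: ('v \<Rightarrow> nat) set) c. finite A \<and>
     f = (\<lambda>x. \<Sum>a\<in>A. c a * (\<Prod>i\<in>UNIV. x $ i ^ a i)))"

definition form_of_degree :: "nat \<Rightarrow> (complex ^ 'v \<Rightarrow> complex) \<Rightarrow> bool" where
  "form_of_degree d f \<longleftrightarrow> (\<exists>(A :: ('v \<Rightarrow> nat) set) c. finite A \<and>
     (\<forall>a\<in>A. (\<Sum>i\<in>UNIV. a i) = d) \<and>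
     f = (\<lambda>x. \<Sum>a\<in>A. c a * (\<Prod>i\<in>UNIV. x $ i ^ a i)))"

definition form :: "(complex ^ 'v \<Rightarrow> complex) \<Rightarrow> bool" where
  "form f \<longleftrightarrow> (\<exists>d. form_of_degree d f)"


section \<open>Complex projective space and dual varieties of hypersurfaces\<close>

definition proportional :: "complex ^ 'v \<Rightarrow> complex ^ 'v \<Rightarrow> bool" where
  "proportional u v \<longleftrightarrow> u \<noteq> 0 \<and> v \<noteq> 0 \<and> (\<exists>c. u = c *s v)"

lemma part_equivp_proportional: "part_equivp (proportional :: complex ^ 'v \<Rightarrow> _)"
proof (rule part_equivpI)
  have "(vec 1 :: complex ^ 'v) \<noteq> 0"
    by (simp add: vec_eq_iff)
  then show "\<exists>x :: complex ^ 'v. proportional x x"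
    unfolding proportional_def by (metis vec.scale_one)
  show "symp (proportional :: complex ^ 'v \<Rightarrow> _)"
  proof (rule sympI)
    fix u v :: "complex ^ 'v"
    assume "proportional u v"
    then obtain c where c: "u \<noteq> 0" "v \<noteq> 0" "u = c *s v"
      unfolding proportional_def by blast
    then have "c \<noteq> 0" by auto
    then have "v = inverse c *s u" using c(3) by (simp add: vec.scale_scale)
    with c show "proportional v u" unfolding proportional_def by blast
  qed
  show "transp (proportional :: complex ^ 'v \<Rightarrow> _)"
    by (rule transpI) (auto simp: proportional_def)
qed

text \<open>For an index type with \<open>m + 1\<close> elements, the type \<open>'v cproj\<close> is the complex
  projective space of dimension \<open>m\<close>; \<open>abs_cproj v\<close> is the point with homogeneous coordinates
  \<open>v\<close>, and it is meaningful only for \<open>v \<noteq> 0\<close>. The dual projective space is the same type.\<close>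

quotient_type (overloaded) 'v cproj = "complex ^ 'v" / partial: proportional
  by (rule part_equivp_proportional)

definition zero_locus :: "(complex ^ 'v \<Rightarrow> complex) \<Rightarrow> ('v :: finite) cproj set" where
  "zero_locus f = {abs_cproj v | v. v \<noteq> 0 \<and> f v = 0}"

definition vanishing_forms :: "('v :: finite) cproj set \<Rightarrow> (complex ^ 'v \<Rightarrow> complex) set" where
  "vanishing_forms X = {f. form f \<and> (\<forall>v. v \<noteq> 0 \<longrightarrow> abs_cproj v \<in> X \<longrightarrow> f v = 0)}"

definition zariski_closure :: "('v :: finite) cproj set \<Rightarrow> ('v :: finite) cproj set" where
  "zariski_closure S = (\<Inter>f\<in>vanishing_forms S. zero_locus f)"

text \<open>A defining polynomial of a hypersurface generates its homogeneous ideal.\<close>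

definition defining_polynomial :: "('v :: finite) cproj set \<Rightarrow> (complex ^ 'v \<Rightarrow> complex) \<Rightarrow> bool" where
  "defining_polynomial X q \<longleftrightarrow> form q \<and> X = zero_locus q \<and>
     vanishing_forms X = {f. form f \<and> (\<exists>g. polynomial_fun g \<and> f = (\<lambda>x. q x * g x))}"

text \<open>The Zariski tangent space at \<open>x\<close> of the affine cone over \<open>X\<close>, that is, the vector space
  whose projectivization is the embedded tangent space of \<open>X\<close> at the point \<open>abs_cproj x\<close>.\<close>

definition tangent_space :: "('v :: finite) cproj set \<Rightarrow> complex ^ 'v \<Rightarrow> (complex ^ 'v) set" where
  "tangent_space X x = {v. \<forall>f\<in>vanishing_forms X. deriv (\<lambda>t. f (x + t *s v)) 0 = 0}"

text \<open>The Jacobian criterion in codimension one: these are the smooth points of \<open>X\<close> if \<open>X\<close> is a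
  hypersurface.\<close>

definition smooth_at :: "('v :: finite) cproj set \<Rightarrow> complex ^ 'v \<Rightarrow> bool" where
  "smooth_at X x \<longleftrightarrow> x \<noteq> 0 \<and> abs_cproj x \<in> X \<and> vec.dim (tangent_space X x) = CARD('v) - 1"

definition hyperplane :: "complex ^ 'v \<Rightarrow> (complex ^ 'v) set" where
  "hyperplane u = {v. scalar_product u v = 0}"

definition dual_variety :: "('v :: finite) cproj set \<Rightarrow> ('v :: finite) cproj set" where
  "dual_variety X = zariski_closure
     {abs_cproj u | u. u \<noteq> 0 \<and> (\<exists>x. smooth_at X x \<and> tangent_space X x \<subseteq> hyperplane u)}"


section \<open>The coordinatewise inversion\<close>

definition torus :: "(complex ^ 'v) set" where
  "torus = {x. \<forall>i. x $ i \<noteq> 0}"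

definition vinverse :: "complex ^ 'v \<Rightarrow> complex ^ 'v" where
  "vinverse x = (\<chi> i. inverse (x $ i))"

text \<open>The inversion is only a birational map, so a variety is transformed by taking the closure of
  the image of the part on which all coordinates are nonzero.\<close>

definition mobius_image :: "('v :: finite) cproj set \<Rightarrow> ('v :: finite) cproj set" where
  "mobius_image X = zariski_closure {abs_cproj (vinverse u) | u. u \<in> torus \<and> abs_cproj u \<in> X}"

text \<open>The polynomial \<open>(\<Prod>i. x\<^sub>i)\<^sup>d f(1/x)\<close>. The formula is only used where it makes sense, as
  \<open>inverse 0 = 0\<close> would give wrong values on the coordinate hyperplanes.\<close>

definition is_reciprocal ::
    "nat \<Rightarrow> (complex ^ 'v \<Rightarrow> complex) \<Rightarrow> (complex ^ 'v \<Rightarrow> complex) \<Rightarrow> bool" where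
  "is_reciprocal d f g \<longleftrightarrow> polynomial_fun g \<and>
     (\<forall>x\<in>torus. g x = (\<Prod>i\<in>UNIV. x $ i) ^ d * f (vinverse x))"

definition reciprocal :: "nat \<Rightarrow> (complex ^ 'v \<Rightarrow> complex) \<Rightarrow> complex ^ 'v \<Rightarrow> complex" where
  "reciprocal d f = (THE g. is_reciprocal d f g)"

text \<open>The effect of the inversion on defining polynomials: substitute \<open>1/x\<^sub>i\<close> for every \<open>x\<^sub>i\<close> and
  clear denominators by a monomial, leaving no coordinate as a factor.\<close>

definition mobius_transform ::
    "(complex ^ 'v \<Rightarrow> complex) \<Rightarrow> (complex ^ 'v \<Rightarrow> complex) \<Rightarrow> bool" where
  "mobius_transform q g \<longleftrightarrow> polynomial_fun g \<and>
     (\<exists>e. \<forall>x\<in>torus. g x = (\<Prod>i\<in>UNIV. x $ i ^ e i) * q (vinverse x)) \<and>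
     (\<forall>i. \<not> (\<exists>h. polynomial_fun h \<and> g = (\<lambda>x. x $ i * h x)))"

definition duality_shift ::
    "(complex ^ 'v \<Rightarrow> complex) \<Rightarrow> (complex ^ 'v \<Rightarrow> complex) \<Rightarrow> bool" where
  "duality_shift f g \<longleftrightarrow>
     (\<exists>q. defining_polynomial (dual_variety (zero_locus f)) q \<and> mobius_transform q g)"


section \<open>The polynomials and the multivalued operations\<close>

text \<open>The variables are indexed by \<open>'m option\<close> with \<open>m = CARD('m)\<close>: the coordinate \<open>Some j\<close> is
  \<open>x\<^sub>j\<close> (dually \<open>u\<^sub>j\<close>) and the coordinate \<open>None\<close> is \<open>z\<close> (dually \<open>w\<close>).\<close>

definition nroot :: "nat \<Rightarrow> complex \<Rightarrow> complex" where
  "nroot n x = x powr (1 / of_nat n)"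

definition p_poly :: "nat \<Rightarrow> complex ^ ('m :: finite) option \<Rightarrow> complex" where
  "p_poly n x = (\<Prod>k\<in>PiE UNIV (\<lambda>_ :: 'm. {1..n}).
     nroot n (x $ None) + (\<Sum>j\<in>UNIV. exp (2 * pi * \<i> / of_nat n) ^ k j * nroot n (x $ Some j)))"

text \<open>The principal branches in \<open>nroot\<close> are irrelevant: any choice of the roots, independently
  for every variable, gives the same value.\<close>

lemma p_poly_any_branch:
  fixes x :: "complex ^ ('m :: finite) option"
  assumes n: "n \<ge> 1" and s: "\<And>i. s i ^ n = x $ i"
  shows "p_poly n x = (\<Prod>k\<in>PiE UNIV (\<lambda>_ :: 'm. {1..n}).
     s None + (\<Sum>j\<in>UNIV. exp (2 * pi * \<i> / of_nat n) ^ k j * s (Some j)))"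
proof -
  define e where "e = exp (2 * pi * \<i> / of_nat n)"
  define R where "R = {w :: complex. w ^ n = 1}"
  have e_cis: "e ^ k = cis (2 * pi * real k / real n)" for k
    unfolding e_def cis_conv_exp exp_of_nat_mult[symmetric] by (simp add: field_simps)
  have e_n: "e ^ n = 1"
    using n by (simp add: e_cis)
  have "bij_betw (\<lambda>k. e ^ k) {..<n} R"
    unfolding e_cis R_def using Complex.bij_betw_roots_unity[of n] n by simp
  moreover have "bij_betw (\<lambda>k. k mod n) {1..n} {..<n}"
  proof (rule bij_betw_byWitness[where f' = "\<lambda>k. if k = 0 then n else k"])
    show "\<forall>k\<in>{1..n}. (if k mod n = 0 then n else k mod n) = k"
      by (auto simp: mod_if)
  qed (use n in auto)
  ultimately have "bij_betw ((\<lambda>k. e ^ k) \<circ> (\<lambda>k. k mod n)) {1..n} R"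
    by (rule bij_betw_trans[rotated])
  moreover have "e ^ (k mod n) = e ^ k" for k
  proof -
    have "e ^ k = e ^ (n * (k div n) + k mod n)" by simp
    also have "\<dots> = e ^ (k mod n)" by (simp only: power_add power_mult e_n) simp
    finally show ?thesis by simp
  qed
  ultimately have bij: "bij_betw (\<lambda>k. e ^ k) {1..n} R"
    by (simp add: comp_def)
  define F where "F = PiE UNIV (\<lambda>_ :: 'm. {1..n})"
  define FR where "FR = {r :: 'm \<Rightarrow> complex. \<forall>j. r j \<in> R}"
  have bijF: "bij_betw (\<lambda>k j. e ^ k j) F FR"
  proof (rule bij_betw_byWitness[where f' = "\<lambda>r j. inv_into {1..n} (\<lambda>k. e ^ k) (r j)"])
    show "\<forall>k\<in>F. (\<lambda>j. inv_into {1..n} ((^) e) (e ^ k j)) = k"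
      using bij by (auto simp: F_def bij_betw_def inv_into_f_f PiE_iff fun_eq_iff)
    show "\<forall>r\<in>FR. (\<lambda>j. e ^ inv_into {1..n} ((^) e) (r j)) = r"
      using bij by (auto simp: FR_def bij_betw_def f_inv_into_f fun_eq_iff)
    show "(\<lambda>k j. e ^ k j) ` F \<subseteq> FR"
      using bij by (auto simp: F_def FR_def bij_betw_def PiE_iff)
    show "(\<lambda>r j. inv_into {1..n} ((^) e) (r j)) ` FR \<subseteq> F"
      using bij by (auto simp: F_def FR_def bij_betw_def PiE_iff simp del: atLeastAtMost_iff
        intro!: inv_into_into)
  qed
  have reindex: "(\<Prod>k\<in>F. t None + (\<Sum>j\<in>UNIV. e ^ k j * t (Some j))) =
      (\<Prod>r\<in>FR. t None + (\<Sum>j\<in>UNIV. r j * t (Some j)))" for t :: "'m option \<Rightarrow> complex"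
    by (rule prod.reindex_bij_betw[OF bijF, where g = "\<lambda>r. t None + (\<Sum>j\<in>UNIV. r j * t (Some j))"])
  have card_FR: "card FR = n ^ CARD('m)"
    using bij_betw_same_card[OF bijF] by (simp add: F_def card_PiE)
  have "nroot n (x $ i) ^ n = x $ i" for i
    using n by (cases "x $ i = 0") (auto simp: nroot_def powr_def exp_of_nat_mult[symmetric])
  then have "\<exists>b. b \<in> R \<and> nroot n (x $ i) = b * s i" for i
  proof (cases "x $ i = 0")
    case True
    then show ?thesis using s[of i] n by (intro exI[of _ 1]) (auto simp: R_def nroot_def)
  next
    case False
    then have "s i \<noteq> 0" using s[of i] n by (auto simp: power_0_left)
    with False \<open>\<And>i. nroot n (x $ i) ^ n = x $ i\<close> s show ?thesis
      by (intro exI[of _ "nroot n (x $ i) / s i"]) (auto simp: R_def power_divide)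
  qed
  then have "\<exists>b. \<forall>i. b i \<in> R \<and> nroot n (x $ i) = b i * s i"
    by (intro choice allI)
  then obtain b where "\<forall>i. b i \<in> R \<and> nroot n (x $ i) = b i * s i" ..
  then have b: "\<And>i. b i ^ n = 1" "\<And>i. nroot n (x $ i) = b i * s i"
    by (simp_all add: R_def)
  have b0: "b i \<noteq> 0" for i using b(1)[of i] n by (auto simp: power_0_left)
  have bijb: "bij_betw (\<lambda>r j. r j * b (Some j) / b None) FR FR"
    by (rule bij_betw_byWitness[where f' = "\<lambda>r j. r j / b (Some j) * b None"])
      (simp_all add: FR_def R_def power_mult_distrib power_divide b(1) b0 image_subset_iff)
  have "p_poly n x = (\<Prod>r\<in>FR. b None * s None + (\<Sum>j\<in>UNIV. r j * (b (Some j) * s (Some j))))"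
    unfolding p_poly_def e_def[symmetric] F_def[symmetric] b
    using reindex[of "\<lambda>i. b i * s i"] by simp
  also have "\<dots> = (\<Prod>r\<in>FR. b None * (s None + (\<Sum>j\<in>UNIV. r j * b (Some j) / b None * s (Some j))))"
    by (rule prod.cong) (simp_all add: distrib_left sum_distrib_left b0 mult.assoc)
  also have "\<dots> = b None ^ card FR *
      (\<Prod>r\<in>FR. s None + (\<Sum>j\<in>UNIV. r j * b (Some j) / b None * s (Some j)))"
    by (simp add: prod.distrib)
  also have "b None ^ card FR = 1"
  proof -
    have "n ^ CARD('m) = n * n ^ (CARD('m) - 1)"
      by (metis power_minus_mult mult.commute zero_less_card_finite)
    then show ?thesis by (simp add: card_FR power_mult b)
  qed
  also have "(\<Prod>r\<in>FR. s None + (\<Sum>j\<in>UNIV. r j * b (Some j) / b None * s (Some j))) =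
      (\<Prod>r\<in>FR. s None + (\<Sum>j\<in>UNIV. r j * s (Some j)))"
    by (rule prod.reindex_bij_betw[OF bijb, where g = "\<lambda>r. s None + (\<Sum>j\<in>UNIV. r j * s (Some j))"])
  finally show ?thesis
    unfolding e_def[symmetric] F_def[symmetric] using reindex[of s] by simp
qed

definition X_var :: "nat \<Rightarrow> ('m :: finite) option cproj set" where
  "X_var n = zero_locus (p_poly n)"

definition P_poly :: "nat \<Rightarrow> complex ^ ('m :: finite) option \<Rightarrow> complex" where
  "P_poly n = reciprocal ((n - 1) ^ (CARD('m) - 1)) (p_poly (n - 1))"

text \<open>The form, homogeneous of degree \<open>N\<close> in every pair \<open>(y\<^sub>i $ 1, y\<^sub>i $ 2)\<close>, whose dehomogenization
  in all the pairs, \<open>x\<^sub>i = y\<^sub>i $ 1 / y\<^sub>i $ 2\<close>, is \<open>f\<close>.\<close>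

definition multihomogenization ::
    "nat \<Rightarrow> (complex ^ 'v \<Rightarrow> complex) \<Rightarrow> (('v \<Rightarrow> complex ^ 2) \<Rightarrow> complex) \<Rightarrow> bool" where
  "multihomogenization N f F \<longleftrightarrow> (\<exists>(A :: ('v \<Rightarrow> nat) set) c. finite A \<and>
     (\<forall>a\<in>A. \<forall>i. a i \<le> N) \<and>
     f = (\<lambda>x. \<Sum>a\<in>A. c a * (\<Prod>i\<in>UNIV. x $ i ^ a i)) \<and>
     F = (\<lambda>y. \<Sum>a\<in>A. c a * (\<Prod>i\<in>UNIV. (y i $ 1) ^ a i * (y i $ 2) ^ (N - a i))))"

text \<open>The graph of the partial \<open>N\<close>-valued operation on the projective line \<open>2 cproj\<close>, in which
  \<open>(x : 1)\<close> is the number \<open>x\<close>, that \<open>f\<close> defines: the value at the points \<open>(ys j $ 1 : ys j $ 2)\<close> is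
  the multiset of the \<open>N\<close> zeros, with multiplicities, of the resulting binary form in the pair
  belonging to the variable \<open>None\<close>; there is no value if that form vanishes identically.\<close>

definition algebraic_operation ::
    "nat \<Rightarrow> (complex ^ ('m :: finite) option \<Rightarrow> complex) \<Rightarrow> ('m \<Rightarrow> 2 cproj) \<Rightarrow> 2 cproj multiset \<Rightarrow> bool" where
  "algebraic_operation N f xs M \<longleftrightarrow> (\<exists>F ys rs c. multihomogenization N f F \<and>
     (\<forall>j. ys j \<noteq> 0 \<and> xs j = abs_cproj (ys j)) \<and>
     length rs = N \<and> (\<forall>r\<in>set rs. r \<noteq> 0) \<and> c \<noteq> 0 \<and>
     (\<forall>\<zeta>. F (case_option \<zeta> ys) = c * (\<Prod>r\<leftarrow>rs. \<zeta> $ 1 * r $ 2 - \<zeta> $ 2 * r $ 1)) \<and>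
     M = mset (map abs_cproj rs))"

definition O_operation :: "nat \<Rightarrow> ('m :: finite \<Rightarrow> 2 cproj) \<Rightarrow> 2 cproj multiset \<Rightarrow> bool" where
  "O_operation n = algebraic_operation (n ^ (CARD('m) - 1)) (p_poly n)"

end

theory Submission
  imports Defs "HOL-Computational_Algebra.Polynomial"
begin

text \<open>Substituting \<open>x\<^sub>i = y\<^sub>i\<^sup>n\<close> turns \<open>p\<^sub>n\<close> into the product of the linear forms
  \<open>y\<^sub>0 + \<Sum>\<^sub>j r\<^sub>j y\<^sub>j\<close> over all tuples \<open>r\<close> of \<open>n\<close>-th roots of unity (\<open>p_poly_vpow\<close>), where \<open>0\<close> stands
  for the index \<open>None\<close>. So \<open>X\<^sub>n\<close> is the image of the single hyperplane \<open>\<Sum>\<^sub>i y\<^sub>i = 0\<close> under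
  \<open>y \<mapsto> y\<^sup>n\<close> (\<open>p_poly_zero_root\<close>). Along this hyperplane the chain rule makes the gradient of
  \<open>p\<^sub>n\<close> at \<open>y\<^sup>n\<close> proportional to the vector with the coordinates \<open>y\<^sub>i\<^sup>1\<^sup>-\<^sup>n\<close>
  (\<open>p_poly_gradient_generic\<close>): the tangent hyperplane of \<open>X\<^sub>n\<close> at \<open>y\<^sup>n\<close> is the
  coordinatewise inverse of \<open>y\<^sup>n\<^sup>-\<^sup>1\<close>, and \<open>y\<^sup>n\<^sup>-\<^sup>1\<close> is the general point of \<open>X\<^sub>n\<^sub>-\<^sub>1\<close>. This is the
  shift.

  To get the scheme-theoretic statement, that is, the ideals and not just the point sets, the central
  fact is that \<open>p\<^sub>n\<close> divides every polynomial \<open>f\<close> that vanishes at the zeros of \<open>p\<^sub>n\<close> in the torus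
  (\<open>p_poly_dvd\<close>). Indeed \<open>f(y\<^sup>n)\<close> vanishes on the hyperplanes of all the linear forms above.
  They are pairwise different, so their product \<open>p\<^sub>n(y\<^sup>n)\<close> divides \<open>f(y\<^sup>n)\<close>; the quotient is
  invariant under the multiplication of the coordinates by roots of unity, hence it is a polynomial in
  \<open>y\<^sup>n\<close> (\<open>has_exponents_descend\<close>).

  A form that vanishes at all tangent hyperplanes becomes, after the inversion, a polynomial that
  vanishes at the general point of \<open>X\<^sub>n\<^sub>-\<^sub>1\<close>, hence a multiple of \<open>p\<^sub>n\<^sub>-\<^sub>1\<close>; inverting back, the form is
  a multiple of the reciprocal \<open>P\<^sub>n\<close> up to a monomial, and the monomial can be cancelled because \<open>P\<^sub>n\<close> is
  divisible by no coordinate (\<open>reciprocal_p_poly_dvd\<close>). Conversely \<open>P\<^sub>n\<close> vanishes at the gradient of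
  \<open>p\<^sub>n\<close> at every point of \<open>X\<^sub>n\<close>, because this is a polynomial condition that holds
  generically (\<open>reciprocal_vanishes_on_gradient\<close>). So \<open>P\<^sub>n\<close> generates the ideal of the dual variety.

  A generator of that ideal is unique up to a constant, and the condition that no coordinate
  divides the result forces the monomial in the inversion of \<open>c P\<^sub>n\<close> to be the one that gives
  \<open>c p\<^sub>n\<^sub>-\<^sub>1\<close> (\<open>mobius_transform_reciprocal_p_poly\<close>).\<close>

section \<open>Polynomial functions with prescribed exponents\<close>

abbreviation monomial :: "('v::finite \<Rightarrow> nat) \<Rightarrow> complex ^ 'v \<Rightarrow> complex" where
  "monomial a x \<equiv> (\<Prod>i\<in>UNIV. x $ i ^ a i)"

text \<open>Forms and arbitrary polynomial functions are both given by a restriction on the exponents of the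
  monomials. Keeping the set of exponents as a parameter lets one proof serve for both.\<close>

definition has_exponents :: "('v::finite \<Rightarrow> nat) set \<Rightarrow> (complex ^ 'v \<Rightarrow> complex) \<Rightarrow> bool" where
  "has_exponents S f \<longleftrightarrow> (\<exists>A c. finite A \<and> A \<subseteq> S \<and> f = (\<lambda>x. \<Sum>a\<in>A. c a * monomial a x))"

lemma polynomial_fun_iff_has_exponents: "polynomial_fun f \<longleftrightarrow> has_exponents UNIV f"
  by (auto simp: polynomial_fun_def has_exponents_def)

lemma form_of_degree_iff_has_exponents:
  "form_of_degree d f \<longleftrightarrow> has_exponents {a. (\<Sum>i\<in>UNIV. a i) = d} f"
  by (simp add: form_of_degree_def has_exponents_def subset_eq)

lemma has_exponents_mono:
  assumes "has_exponents S f" "S \<subseteq> T"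
  shows "has_exponents T f"
proof -
  obtain A c where "finite A" "A \<subseteq> S" "f = (\<lambda>x. \<Sum>a\<in>A. c a * monomial a x)"
    using assms(1) unfolding has_exponents_def by blast
  with assms(2) show ?thesis
    unfolding has_exponents_def by (intro exI[of _ A] exI[of _ c]) auto
qed

lemma has_exponents_imp_polynomial_fun: "has_exponents S f \<Longrightarrow> polynomial_fun f"
  using has_exponents_mono[of S f UNIV] by (simp add: polynomial_fun_iff_has_exponents)

text \<open>Equal exponents may occur repeatedly, as they do in a sum or in a product of two polynomials.\<close>

lemma has_exponents_collect:
  assumes "finite K" and "\<alpha> ` K \<subseteq> S"
  shows "has_exponents S (\<lambda>x. \<Sum>k\<in>K. c k * monomial (\<alpha> k) x)"
proof -
  have "(\<Sum>k\<in>K. c k * monomial (\<alpha> k) x) =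
      (\<Sum>a\<in>\<alpha> ` K. (\<Sum>k | k \<in> K \<and> \<alpha> k = a. c k) * monomial a x)" for x
  proof -
    have "(\<Sum>k\<in>K. c k * monomial (\<alpha> k) x) =
        (\<Sum>a\<in>\<alpha> ` K. \<Sum>k | k \<in> K \<and> \<alpha> k = a. c k * monomial (\<alpha> k) x)"
      by (rule sum.image_gen[OF \<open>finite K\<close>])
    also have "\<dots> = (\<Sum>a\<in>\<alpha> ` K. \<Sum>k | k \<in> K \<and> \<alpha> k = a. c k * monomial a x)"
      by (intro sum.cong refl) auto
    finally show ?thesis
      by (simp only: sum_distrib_right)
  qed
  with assms show ?thesis
    unfolding has_exponents_def
    by (intro exI[of _ "\<alpha> ` K"] exI[of _ "\<lambda>a. \<Sum>k | k \<in> K \<and> \<alpha> k = a. c k"]) simp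
qed

lemma has_exponents_add:
  assumes "has_exponents S f" "has_exponents S g"
  shows "has_exponents S (\<lambda>x. f x + g x)"
proof -
  obtain A c where A: "finite A" "A \<subseteq> S" "f = (\<lambda>x. \<Sum>a\<in>A. c a * monomial a x)"
    using assms(1) unfolding has_exponents_def by blast
  obtain B d where B: "finite B" "B \<subseteq> S" "g = (\<lambda>x. \<Sum>a\<in>B. d a * monomial a x)"
    using assms(2) unfolding has_exponents_def by blast
  have "has_exponents S (\<lambda>x. \<Sum>k\<in>A <+> B. case_sum c d k * monomial (case_sum id id k) x)"
    by (rule has_exponents_collect) (use A B in auto)
  then show ?thesis
    using A B by (simp add: sum.Plus)
qed

lemma has_exponents_mult:
  assumes "has_exponents S f" "has_exponents T g"
    and U: "\<And>a b. a \<in> S \<Longrightarrow> b \<in> T \<Longrightarrow> (\<lambda>i. a i + b i) \<in> U"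
  shows "has_exponents U (\<lambda>x. f x * g x)"
proof -
  obtain A c where A: "finite A" "A \<subseteq> S" "f = (\<lambda>x. \<Sum>a\<in>A. c a * monomial a x)"
    using assms(1) unfolding has_exponents_def by blast
  obtain B d where B: "finite B" "B \<subseteq> T" "g = (\<lambda>x. \<Sum>a\<in>B. d a * monomial a x)"
    using assms(2) unfolding has_exponents_def by blast
  have "has_exponents U (\<lambda>x. \<Sum>k\<in>A \<times> B. (c (fst k) * d (snd k)) *
      monomial (\<lambda>i. fst k i + snd k i) x)"
  proof (rule has_exponents_collect)
    show "(\<lambda>k i. fst k i + snd k i) ` (A \<times> B) \<subseteq> U"
      using A(2) B(2) U by (auto simp: subset_eq)
  qed (use A B in simp)
  also have "(\<lambda>x. \<Sum>k\<in>A \<times> B. (c (fst k) * d (snd k)) * monomial (\<lambda>i. fst k i + snd k i) x)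
      = (\<lambda>x. f x * g x)"
    unfolding A(3) B(3) sum_product sum.cartesian_product
    by (intro ext sum.cong) (auto simp: power_add prod.distrib)
  finally show ?thesis .
qed

lemma has_exponents_monomial: "a \<in> S \<Longrightarrow> has_exponents S (\<lambda>x. c * monomial a x)"
  using has_exponents_collect[of "{()}" "\<lambda>_. a" S "\<lambda>_. c"] by simp

lemma monomial_unit:
  fixes x :: "complex ^ 'v::finite"
  shows "monomial (\<lambda>j. if j = i then 1 else 0) x = x $ i"
proof -
  have "monomial (\<lambda>j. if j = i then 1 else 0) x = (\<Prod>j\<in>UNIV. if j = i then x $ j else 1)"
    by (intro prod.cong) auto
  then show ?thesis by simp
qed

lemma has_exponents_zero: "has_exponents S (\<lambda>x. 0)"
  using has_exponents_collect[of "{}" undefined S] by simp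

lemma has_exponents_sum:
  assumes "\<And>k. k \<in> K \<Longrightarrow> has_exponents S (f k)"
  shows "has_exponents S (\<lambda>x. \<Sum>k\<in>K. f k x)"
  using assms
  by (induction K rule: infinite_finite_induct) (auto intro: has_exponents_zero has_exponents_add)

lemma polynomial_fun_const: "polynomial_fun (\<lambda>x. c)"
  using has_exponents_monomial[of "\<lambda>_. 0" UNIV c] by (simp add: polynomial_fun_iff_has_exponents)

lemma polynomial_fun_coord: "polynomial_fun (\<lambda>x. x $ i)"
  using has_exponents_monomial[of "\<lambda>j. if j = i then 1 else 0" UNIV 1]
  unfolding polynomial_fun_iff_has_exponents monomial_unit by simp

lemma polynomial_fun_add: "polynomial_fun f \<Longrightarrow> polynomial_fun g \<Longrightarrow> polynomial_fun (\<lambda>x. f x + g x)"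
  by (simp add: polynomial_fun_iff_has_exponents has_exponents_add)

lemma polynomial_fun_mult: "polynomial_fun f \<Longrightarrow> polynomial_fun g \<Longrightarrow> polynomial_fun (\<lambda>x. f x * g x)"
  unfolding polynomial_fun_iff_has_exponents by (erule (1) has_exponents_mult) simp

lemma polynomial_fun_diff:
  "polynomial_fun f \<Longrightarrow> polynomial_fun g \<Longrightarrow> polynomial_fun (\<lambda>x. f x - g x)"
  using polynomial_fun_add[OF _ polynomial_fun_mult[OF polynomial_fun_const[of "-1"]], of f g] by simp

lemma polynomial_fun_sum:
  "(\<And>k. k \<in> K \<Longrightarrow> polynomial_fun (f k)) \<Longrightarrow> polynomial_fun (\<lambda>x. \<Sum>k\<in>K. f k x)"
  by (induction K rule: infinite_finite_induct) (auto intro: polynomial_fun_const polynomial_fun_add)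

lemma polynomial_fun_prod:
  "(\<And>k. k \<in> K \<Longrightarrow> polynomial_fun (f k)) \<Longrightarrow> polynomial_fun (\<lambda>x. \<Prod>k\<in>K. f k x)"
  by (induction K rule: infinite_finite_induct) (auto intro: polynomial_fun_const polynomial_fun_mult)

lemma polynomial_fun_power: "polynomial_fun f \<Longrightarrow> polynomial_fun (\<lambda>x. f x ^ k)"
  by (induction k) (auto intro: polynomial_fun_const polynomial_fun_mult)

lemmas polynomial_fun_intros = polynomial_fun_const polynomial_fun_coord polynomial_fun_add
  polynomial_fun_mult polynomial_fun_diff polynomial_fun_sum polynomial_fun_prod polynomial_fun_power

text \<open>The polynomial functions are generated by the constants and the coordinates. This is the form in
  which substitution, restriction to lines, remainders and derivatives are proved below.\<close>

lemma polynomial_fun_induct [consumes 1, case_names const coord add mult]: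
  assumes "polynomial_fun f"
    and const: "\<And>c. P (\<lambda>x. c)"
    and coord: "\<And>i. P (\<lambda>x. x $ i)"
    and add: "\<And>f g. polynomial_fun f \<Longrightarrow> polynomial_fun g \<Longrightarrow> P f \<Longrightarrow> P g \<Longrightarrow> P (\<lambda>x. f x + g x)"
    and mult: "\<And>f g. polynomial_fun f \<Longrightarrow> polynomial_fun g \<Longrightarrow> P f \<Longrightarrow> P g \<Longrightarrow> P (\<lambda>x. f x * g x)"
  shows "P f"
proof -
  let ?Q = "\<lambda>f. polynomial_fun f \<and> P f"
  have power: "?Q (\<lambda>x. x $ i ^ k)" for i k
    by (induction k) (auto intro: polynomial_fun_intros const coord mult)
  have monomial: "?Q (\<lambda>x. \<Prod>i\<in>I. x $ i ^ a i)" if "finite I" for I and a :: "'a \<Rightarrow> nat"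
    using that
    by (induction I) (use power in \<open>auto intro: polynomial_fun_mult polynomial_fun_const const mult\<close>)
  have "?Q (\<lambda>x. \<Sum>a\<in>A. c a * monomial a x)" if "finite A" for A and c :: "('a \<Rightarrow> nat) \<Rightarrow> complex"
    using that
    by (induction A) (use monomial in \<open>auto intro!: polynomial_fun_mult polynomial_fun_add
      polynomial_fun_const const mult add\<close>)
  with assms(1) show ?thesis
    unfolding polynomial_fun_def by blast
qed

lemma polynomial_fun_subst:
  assumes "polynomial_fun f" and "\<And>i. polynomial_fun (w i)"
  shows "polynomial_fun (\<lambda>x. f (\<chi> i. w i x))"
  using assms(1)
  by (induction rule: polynomial_fun_induct) (auto intro: polynomial_fun_intros assms(2))

section \<open>Divisibility of polynomial functions\<close>

text \<open>Restriction to lines reduces the ring-theoretic facts that follow to polynomials in one variable.\<close>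

lemma polynomial_fun_on_line:
  assumes "polynomial_fun f"
  shows "\<exists>q. \<forall>t. f (a + t *s v) = poly q t"
  using assms
proof (induction rule: polynomial_fun_induct)
  case (const c)
  show ?case by (intro exI[of _ "[:c:]"]) simp
next
  case (coord i)
  show ?case by (intro exI[of _ "[:a $ i, v $ i:]"]) (simp add: mult.commute)
next
  case (add f g)
  then show ?case by (metis poly_add)
next
  case (mult f g)
  then show ?case by (metis poly_mult)
qed

text \<open>Restrict to the line through \<open>a\<close> and an arbitrary point \<open>b\<close>. It follows that
  an identity may be checked off the zeros of any nonzero polynomial function.\<close>

lemma polynomial_fun_zero_divisor:
  assumes "polynomial_fun f" "polynomial_fun g" and "\<And>x. f x * g x = 0" and "f a \<noteq> 0"
  shows "g = (\<lambda>x. 0)"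
proof
  fix b
  obtain q where q: "\<And>t. f (a + t *s (b - a)) = poly q t"
    using polynomial_fun_on_line[OF assms(1)] by metis
  obtain r where r: "\<And>t. g (a + t *s (b - a)) = poly r t"
    using polynomial_fun_on_line[OF assms(2)] by metis
  have "poly (q * r) = poly 0"
    using assms(3) by (auto simp: q[symmetric] r[symmetric])
  then have "q * r = 0"
    by (simp only: poly_eq_poly_eq_iff)
  moreover have "q \<noteq> 0"
    using q[of 0] \<open>f a \<noteq> 0\<close> by auto
  ultimately have "r = 0" by simp
  then show "g b = 0"
    using r[of 1] by simp
qed

lemma polynomial_fun_unit_const:
  assumes "polynomial_fun f" "polynomial_fun g" and "\<And>x. f x * g x = 1"
  shows "\<exists>c. c \<noteq> 0 \<and> f = (\<lambda>x. c)"
proof (intro exI conjI ext)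
  show "f 0 \<noteq> 0" using assms(3)[of 0] by auto
  fix b
  obtain q where q: "\<And>t. f (0 + t *s b) = poly q t"
    using polynomial_fun_on_line[OF assms(1)] by metis
  obtain r where r: "\<And>t. g (0 + t *s b) = poly r t"
    using polynomial_fun_on_line[OF assms(2)] by metis
  have "poly (q * r) = poly 1"
    using assms(3) by (auto simp: q[symmetric] r[symmetric])
  then have "q * r = 1"
    by (simp only: poly_eq_poly_eq_iff)
  then have "is_unit q" by (metis dvd_triv_left)
  then obtain c where "q = [:c:]" by (auto simp: is_unit_poly_iff)
  then show "f b = f 0"
    using q[of 0] q[of 1] by simp
qed

text \<open>Division with remainder by the monic linear polynomial \<open>x\<^sub>i - w(x)\<close>, where the remainder is
  obtained by substituting \<open>w\<close> for the variable \<open>x\<^sub>i\<close>. In particular a polynomial that vanishes on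
  the graph \<open>x\<^sub>i = w\<close> is divisible by \<open>x\<^sub>i - w\<close>.\<close>

lemma polynomial_fun_split_factor:
  assumes "polynomial_fun f" and w: "polynomial_fun w"
  shows "\<exists>g. polynomial_fun g \<and>
    (\<forall>x. f x - f (\<chi> j. if j = i then w x else x $ j) = (x $ i - w x) * g x)"
proof -
  let ?s = "\<lambda>x. \<chi> j. if j = i then w x else x $ j"
  have s: "polynomial_fun (\<lambda>x. f (?s x))" if "polynomial_fun f" for f
    using that
  proof (rule polynomial_fun_subst)
    show "polynomial_fun (\<lambda>x. if j = i then w x else x $ j)" for j
      by (cases "j = i") (auto intro: w polynomial_fun_coord)
  qed
  show ?thesis
    using assms(1)
  proof (induction rule: polynomial_fun_induct)
    case (const c)
    show ?case by (intro exI[of _ "\<lambda>x. 0"]) (simp add: polynomial_fun_const)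
  next
    case (coord k)
    show ?case by (intro exI[of _ "\<lambda>x. if k = i then 1 else 0"]) (simp add: polynomial_fun_const)
  next
    case (add f g)
    then obtain f' g' where f'g': "polynomial_fun f'" "polynomial_fun g'"
      "\<And>x. f x - f (?s x) = (x $ i - w x) * f' x" "\<And>x. g x - g (?s x) = (x $ i - w x) * g' x"
      by blast
    then show ?case
      by (intro exI[of _ "\<lambda>x. f' x + g' x"])
        (simp add: polynomial_fun_add add_diff_add distrib_left)
  next
    case (mult f g)
    then obtain f' g' where f'g': "polynomial_fun f'" "polynomial_fun g'"
      "\<And>x. f x - f (?s x) = (x $ i - w x) * f' x" "\<And>x. g x - g (?s x) = (x $ i - w x) * g' x"
      by blast
    have "f x * g x - f (?s x) * g (?s x) = (x $ i - w x) * (f' x * g x + f (?s x) * g' x)" for x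
    proof -
      have "f x * g x - f (?s x) * g (?s x) = (f x - f (?s x)) * g x + f (?s x) * (g x - g (?s x))"
        by (simp add: algebra_simps)
      then show ?thesis unfolding f'g' by (simp add: algebra_simps)
    qed
    then show ?case
      using f'g' mult s by (intro exI[of _ "\<lambda>x. f' x * g x + f (?s x) * g' x"])
        (auto intro!: polynomial_fun_add polynomial_fun_mult)
  qed
qed

lemma polynomial_fun_eqI_torus:
  assumes "polynomial_fun f" "polynomial_fun g" and "\<And>x. x \<in> torus \<Longrightarrow> f x = g x"
  shows "f = g"
proof -
  have "(\<lambda>x. f x - g x) = (\<lambda>x. 0)"
  proof (rule polynomial_fun_zero_divisor)
    show "polynomial_fun (\<lambda>x :: complex ^ 'a. \<Prod>i\<in>UNIV. x $ i)"
      by (intro polynomial_fun_intros)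
    show "(\<Prod>i\<in>UNIV. x $ i) * (f x - g x) = 0" for x
      using assms(3)[of x] by (auto simp: torus_def)
    show "(\<Prod>i\<in>UNIV. (vec 1 :: complex ^ 'a) $ i) \<noteq> 0"
      by simp
  qed (use assms in \<open>auto intro: polynomial_fun_intros\<close>)
  then show ?thesis by (simp add: fun_eq_iff)
qed

lemma polynomial_fun_prod_nonzero:
  assumes "finite K" and "\<And>k. k \<in> K \<Longrightarrow> polynomial_fun (f k)" and "\<And>k. k \<in> K \<Longrightarrow> \<exists>x. f k x \<noteq> 0"
  shows "\<exists>x. (\<Prod>k\<in>K. f k x) \<noteq> 0"
  using assms
proof (induction K)
  case (insert k K)
  then obtain a where a: "f k a \<noteq> 0" by blast
  have "(\<lambda>x. \<Prod>k\<in>K. f k x) \<noteq> (\<lambda>x. 0)"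
    using insert by (auto simp: fun_eq_iff)
  then show ?case
    using polynomial_fun_zero_divisor[of "f k" "\<lambda>x. \<Prod>k\<in>K. f k x", OF _ polynomial_fun_prod _ a]
      insert by auto
qed simp

lemma coordinate_factor:
  assumes "polynomial_fun f" and "\<And>x. x $ i = 0 \<Longrightarrow> f x = 0"
  shows "\<exists>g. polynomial_fun g \<and> (\<forall>x. f x = x $ i * g x)"
  using polynomial_fun_split_factor[OF assms(1) polynomial_fun_const[of 0], of i] assms(2) by auto

text \<open>The functions on the coordinate hyperplane \<open>x\<^sub>i = 0\<close> form an integral domain: compose with the
  projection onto it.\<close>

lemma coordinate_cancel:
  assumes "polynomial_fun f" "polynomial_fun g" and a: "a $ i = 0" "f a \<noteq> 0"
    and 0: "\<And>x. x $ i = 0 \<Longrightarrow> f x * g x = 0" and x: "x $ i = 0"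
  shows "g x = 0"
proof -
  let ?s = "\<lambda>x :: complex ^ 'a. \<chi> j. if j = i then 0 else x $ j"
  have s: "polynomial_fun (\<lambda>x. f (?s x))" if "polynomial_fun f" for f
    using that
  proof (rule polynomial_fun_subst)
    show "polynomial_fun (\<lambda>x. if j = i then 0 else x $ j)" for j
      by (cases "j = i") (auto intro: polynomial_fun_intros)
  qed
  have s_id: "?s x = x" if "x $ i = 0" for x
    using that by (simp add: vec_eq_iff)
  have "(\<lambda>x. g (?s x)) = (\<lambda>x. 0)"
  proof (rule polynomial_fun_zero_divisor)
    show "f (?s x) * g (?s x) = 0" for x
      by (rule 0) simp
    show "f (?s a) \<noteq> 0"
      using a s_id by simp
  qed (use s assms in auto)
  then show ?thesis
    using s_id[OF x] by metis
qed

text \<open>Each coordinate is a prime element that does not divide \<open>q\<close>, so the coordinates on the left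
  divide the other factor \<open>g\<close> and can be cancelled one after the other.\<close>

lemma coordinate_powers_cancel:
  fixes f g q :: "complex ^ 'v::finite \<Rightarrow> complex"
  assumes "polynomial_fun f" "polynomial_fun q" "polynomial_fun g"
    and q: "\<And>i. \<exists>x. x $ i = 0 \<and> q x \<noteq> 0"
    and eq: "\<And>x. (\<Prod>i\<in>UNIV. x $ i) ^ M * f x = q x * g x"
  shows "\<exists>h. polynomial_fun h \<and> (\<forall>x. f x = q x * h x)"
proof -
  have single: "\<exists>h. polynomial_fun h \<and> (\<forall>x. f x = q x * h x)"
    if "polynomial_fun f" "polynomial_fun g" "\<And>x. x $ i ^ k * f x = q x * g x" for f g i k
    using that(2,3)
  proof (induction k arbitrary: g)
    case 0
    then show ?case by auto
  next
    case (Suc k)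
    obtain a where "a $ i = 0" "q a \<noteq> 0" using q by blast
    then have "g x = 0" if "x $ i = 0" for x
      by (rule coordinate_cancel[OF assms(2) Suc.prems(1)]) (use Suc.prems(2)[symmetric] that in auto)
    then obtain g' where g': "polynomial_fun g'" "\<And>x. g x = x $ i * g' x"
      using coordinate_factor[OF Suc.prems(1)] by blast
    have "(\<lambda>x. x $ i ^ k * f x) = (\<lambda>x. q x * g' x)"
    proof (rule polynomial_fun_eqI_torus)
      fix x :: "complex ^ 'v" assume "x \<in> torus"
      moreover have "x $ i * (x $ i ^ k * f x) = x $ i * (q x * g' x)"
        using Suc.prems(2)[of x] g'(2)[of x] by (simp add: algebra_simps)
      ultimately show "x $ i ^ k * f x = q x * g' x"
        by (simp add: torus_def)
    qed (intro polynomial_fun_intros that assms g')+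
    then show ?case
      using Suc.IH[OF g'(1)] by meson
  qed
  have "\<exists>h. polynomial_fun h \<and> (\<forall>x. f x = q x * h x)"
    if "finite I" "polynomial_fun g" "\<And>x. (\<Prod>i\<in>I. x $ i ^ M) * f x = q x * g x" for I g
    using that
  proof (induction I arbitrary: g)
    case empty
    then show ?case by auto
  next
    case (insert i I)
    have "\<exists>h. polynomial_fun h \<and> (\<forall>x. (\<Prod>i\<in>I. x $ i ^ M) * f x = q x * h x)"
    proof (rule single)
      show "x $ i ^ M * ((\<Prod>i\<in>I. x $ i ^ M) * f x) = q x * g x" for x
        using insert.prems(2)[of x] insert.hyps by (simp add: mult.assoc)
    qed (intro polynomial_fun_intros assms insert.prems)+
    then show ?case
      using insert.IH by blast
  qed
  from this[OF finite[of UNIV] assms(3)] show ?thesis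
    using eq by (simp add: prod_power_distrib)
qed

lemma form_of_degree_scale:
  assumes "form_of_degree d f"
  shows "f (c *s x) = c ^ d * f x"
proof -
  obtain A k where A: "\<And>a. a \<in> A \<Longrightarrow> (\<Sum>i\<in>UNIV. a i) = d" "f = (\<lambda>x. \<Sum>a\<in>A. k a * monomial a x)"
    using assms unfolding form_of_degree_def by blast
  have "monomial a (c *s x) = c ^ d * monomial a x" if "a \<in> A" for a
    using A(1)[OF that] by (simp add: power_mult_distrib prod.distrib power_sum[symmetric])
  then show ?thesis
    unfolding A(2) by (simp add: sum_distrib_left mult.left_commute)
qed

lemma form_polynomial_fun: "form f \<Longrightarrow> polynomial_fun f"
  unfolding form_def form_of_degree_iff_has_exponents by (auto intro: has_exponents_imp_polynomial_fun)

lemma form_scale_zero: "form f \<Longrightarrow> f x = 0 \<Longrightarrow> f (c *s x) = 0"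
  unfolding form_def using form_of_degree_scale by fastforce

lemma form_cmult:
  assumes "form f"
  shows "form (\<lambda>x. c * f x)"
proof -
  obtain d where "has_exponents {a. (\<Sum>i\<in>UNIV. a i) = d} f"
    using assms unfolding form_def form_of_degree_iff_has_exponents by blast
  from has_exponents_mult[OF has_exponents_monomial[of "\<lambda>_. 0" "{\<lambda>_. 0}" c] this,
      of "{a. (\<Sum>i\<in>UNIV. a i) = d}"]
  have "has_exponents {a. (\<Sum>i\<in>UNIV. a i) = d} (\<lambda>x. c * f x)"
    by simp
  then show ?thesis
    unfolding form_def form_of_degree_iff_has_exponents by auto
qed

section \<open>Powers and inverses of the coordinates\<close>

definition vpow :: "nat \<Rightarrow> complex ^ 'v \<Rightarrow> complex ^ 'v::finite" where
  "vpow n x = (\<chi> i. x $ i ^ n)"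

lemma vpow_nth [simp]: "vpow n x $ i = x $ i ^ n"
  by (simp add: vpow_def)

lemma complex_root_exists:
  fixes z :: complex
  assumes "n \<ge> 1"
  shows "\<exists>w. w ^ n = z"
proof (cases "z = 0")
  case True
  with assms show ?thesis by (intro exI[of _ 0]) (simp add: power_0_left)
next
  case False
  with assms show ?thesis
    by (intro exI[of _ "exp (Ln z / of_nat n)"]) (simp flip: exp_of_nat_mult)
qed

lemma vpow_surj:
  assumes "n \<ge> 1"
  shows "\<exists>y. vpow n y = x"
proof -
  have "\<forall>i. \<exists>w. w ^ n = x $ i"
    using complex_root_exists[OF assms] by blast
  then obtain y where "\<And>i. y i ^ n = x $ i"
    by metis
  then show ?thesis by (intro exI[of _ "\<chi> i. y i"]) (simp add: vec_eq_iff)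
qed

lemma sum_roots_unity_power:
  assumes "n \<ge> 1"
  shows "(\<Sum>w | w ^ n = 1. w ^ k) = (if n dvd k then of_nat n else (0 :: complex))"
proof (cases "n dvd k")
  case True
  then have "(\<Sum>w :: complex | w ^ n = 1. w ^ k) = (\<Sum>w :: complex | w ^ n = 1. 1)"
    by (intro sum.cong) (auto simp: power_mult)
  then show ?thesis using True assms by (simp add: card_roots_unity_eq)
next
  case False
  \<comment> \<open>Otherwise the \<open>n\<close> roots of unity would all be roots of \<open>z ^ (k mod n) = 1\<close>, which are fewer.\<close>
  have "\<exists>e :: complex. e ^ n = 1 \<and> e ^ k \<noteq> 1"
  proof (rule ccontr)
    assume *: "\<nexists>e :: complex. e ^ n = 1 \<and> e ^ k \<noteq> 1"
    have "e ^ (k mod n) = 1" if "e ^ n = 1" for e :: complex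
    proof -
      have "e ^ k = (e ^ n) ^ (k div n) * e ^ (k mod n)"
        by (simp flip: power_mult power_add)
      with that * show ?thesis by simp
    qed
    then have "card {e :: complex. e ^ n = 1} \<le> card {e :: complex. e ^ (k mod n) = 1}"
      using False by (intro card_mono finite_roots_unity) (auto simp: dvd_eq_mod_eq_0)
    moreover have "k mod n < n" "k mod n \<ge> 1"
      using False assms by (auto simp: dvd_eq_mod_eq_0)
    ultimately show False
      using assms by (simp add: card_roots_unity_eq)
  qed
  then obtain e :: complex where e: "e ^ n = 1" "e ^ k \<noteq> 1" by blast
  have e0: "e \<noteq> 0" using e assms by (auto simp: power_0_left)
  have "(\<Sum>w :: complex | w ^ n = 1. w ^ k) = (\<Sum>w :: complex | w ^ n = 1. (e * w) ^ k)"
    by (rule sum.reindex_bij_betw[symmetric], rule bij_betw_byWitness[where f' = "\<lambda>w. w / e"])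
      (auto simp: power_mult_distrib e e0 power_divide)
  also have "\<dots> = e ^ k * (\<Sum>w :: complex | w ^ n = 1. w ^ k)"
    by (simp add: power_mult_distrib sum_distrib_left)
  finally show ?thesis using e False by simp
qed

text \<open>Two points have the same image under \<open>vpow n\<close> if and only if they differ by \<open>n\<close>-th roots of unity
  in every coordinate. Averaging \<open>f\<close> over these multiplications does not change it, but kills
  every monomial with an exponent that is not divisible by \<open>n\<close>.\<close>

lemma has_exponents_descend:
  fixes f :: "complex ^ 'v::finite \<Rightarrow> complex"
  assumes n: "n \<ge> 1" and f: "has_exponents S f"
    and inv: "\<And>x y. vpow n x = vpow n y \<Longrightarrow> f x = f y"
  shows "\<exists>g. has_exponents {b. (\<lambda>i. n * b i) \<in> S} g \<and> (\<forall>y. f y = g (vpow n y))"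
proof -
  obtain A c where A: "finite A" "A \<subseteq> S" "f = (\<lambda>x. \<Sum>a\<in>A. c a * monomial a x)"
    using f unfolding has_exponents_def by blast
  define R where "R = {w :: complex. w ^ n = 1}"
  define Z where "Z = PiE (UNIV :: 'v set) (\<lambda>_. R)"
  have finR: "finite R" "card R = n"
    unfolding R_def using n finite_roots_unity card_roots_unity_eq by auto
  define A' where "A' = {a \<in> A. \<forall>i. n dvd a i}"
  \<comment> \<open>The average of a monomial is a product of sums of powers over all roots of unity.\<close>
  have avg: "(\<Sum>\<zeta>\<in>Z. \<Prod>i\<in>UNIV. (\<zeta> i * y $ i) ^ a i) =
      (if \<forall>i. n dvd a i then of_nat n ^ CARD('v) * monomial a y else 0)" for a :: "'v \<Rightarrow> nat" and y
  proof -
    have "(\<Sum>\<zeta>\<in>Z. \<Prod>i\<in>UNIV. (\<zeta> i * y $ i) ^ a i) = (\<Prod>i\<in>UNIV. \<Sum>w\<in>R. (w * y $ i) ^ a i)"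
      unfolding Z_def using finR by (subst prod_sum_PiE) auto
    also have "\<dots> = (\<Prod>i\<in>UNIV. (if n dvd a i then of_nat n else 0) * y $ i ^ a i)"
      unfolding power_mult_distrib sum_distrib_right[symmetric] R_def
      by (simp add: sum_roots_unity_power[OF n])
    also have "\<dots> = (if \<forall>i. n dvd a i then of_nat n ^ CARD('v) * monomial a y else 0)"
      by (auto simp: prod.distrib)
    finally show ?thesis .
  qed
  have "f y = (\<Sum>a\<in>A'. c a * monomial a y)" for y
  proof -
    have "of_nat n ^ CARD('v) * f y = (\<Sum>\<zeta>\<in>Z. f y)"
      using finR by (simp add: Z_def card_PiE)
    also have "\<dots> = (\<Sum>\<zeta>\<in>Z. f (\<chi> i. \<zeta> i * y $ i))"
      by (intro sum.cong refl inv) (auto simp: vec_eq_iff Z_def R_def power_mult_distrib PiE_iff)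
    also have "\<dots> = (\<Sum>a\<in>A. c a * (\<Sum>\<zeta>\<in>Z. \<Prod>i\<in>UNIV. (\<zeta> i * y $ i) ^ a i))"
      unfolding A(3) by (subst sum.swap) (simp add: sum_distrib_left)
    also have "\<dots> = (\<Sum>a\<in>A. if \<forall>i. n dvd a i then of_nat n ^ CARD('v) * (c a * monomial a y) else 0)"
      unfolding avg by (intro sum.cong) auto
    also have "\<dots> = (\<Sum>a\<in>A'. of_nat n ^ CARD('v) * (c a * monomial a y))"
      unfolding A'_def using A(1) by (simp add: sum.inter_filter)
    also have "\<dots> = of_nat n ^ CARD('v) * (\<Sum>a\<in>A'. c a * monomial a y)"
      by (simp add: sum_distrib_left)
    finally show ?thesis using n by simp
  qed
  moreover have "monomial a y = monomial (\<lambda>i. a i div n) (vpow n y)" if "a \<in> A'" for a y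
    using that by (intro prod.cong) (auto simp: A'_def simp flip: power_mult)
  ultimately have "f y = (\<Sum>a\<in>A'. c a * monomial (\<lambda>i. a i div n) (vpow n y))" for y
    by simp
  moreover have "has_exponents {b. (\<lambda>i. n * b i) \<in> S}
      (\<lambda>x. \<Sum>a\<in>A'. c a * monomial (\<lambda>i. a i div n) x)"
    by (rule has_exponents_collect) (use A in \<open>auto simp: A'_def\<close>)
  ultimately show ?thesis by blast
qed

lemma vinverse_torus [simp]: "vinverse x \<in> torus \<longleftrightarrow> x \<in> torus"
  by (simp add: vinverse_def torus_def)

lemma vinverse_vinverse [simp]: "vinverse (vinverse x) = x"
  by (simp add: vinverse_def vec_eq_iff)

lemma torus_nonzero: "x \<in> torus \<Longrightarrow> x \<noteq> 0"
  by (auto simp: torus_def)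

lemma prod_vinverse: "(\<Prod>i\<in>UNIV. vinverse x $ i) = inverse (\<Prod>i\<in>UNIV. (x :: complex ^ 'v::finite) $ i)"
  by (simp add: vinverse_def prod_inversef[symmetric] comp_def)

lemma prod_torus_nonzero: "x \<in> torus \<Longrightarrow> (\<Prod>i\<in>UNIV. (x :: complex ^ 'v::finite) $ i) \<noteq> 0"
  by (simp add: torus_def)

lemma has_exponents_reverse:
  fixes f :: "complex ^ 'v::finite \<Rightarrow> complex"
  assumes f: "has_exponents S f" and le: "\<And>a i. a \<in> S \<Longrightarrow> a i \<le> e"
  shows "\<exists>g. has_exponents ((\<lambda>a i. e - a i) ` S) g \<and>
    (\<forall>x\<in>torus. g x = (\<Prod>i\<in>UNIV. x $ i) ^ e * f (vinverse x))"
proof -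
  obtain A c where A: "finite A" "A \<subseteq> S" "f = (\<lambda>x. \<Sum>a\<in>A. c a * monomial a x)"
    using f unfolding has_exponents_def by blast
  have "has_exponents ((\<lambda>a i. e - a i) ` S) (\<lambda>x. \<Sum>a\<in>A. c a * monomial (\<lambda>i. e - a i) x)"
    by (rule has_exponents_collect) (use A in auto)
  moreover have "monomial (\<lambda>i. e - a i) x = (\<Prod>i\<in>UNIV. x $ i) ^ e * monomial a (vinverse x)"
    if "x \<in> torus" "a \<in> A" for x a
  proof -
    have "monomial (\<lambda>i. e - a i) x = (\<Prod>i\<in>UNIV. x $ i ^ e * vinverse x $ i ^ a i)"
      using that le A(2) by (intro prod.cong)
        (auto simp: torus_def vinverse_def power_diff power_inverse divide_inverse subset_eq)
    then show ?thesis by (simp add: prod.distrib prod_power_distrib)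
  qed
  ultimately show ?thesis
    unfolding A(3) by (intro exI[of _ "\<lambda>x. \<Sum>a\<in>A. c a * monomial (\<lambda>i. e - a i) x"])
      (simp add: sum_distrib_left mult.left_commute)
qed

lemma polynomial_fun_bounded_exponents:
  assumes "polynomial_fun f"
  shows "\<exists>e. has_exponents {a. \<forall>i. a i \<le> e} f"
proof -
  obtain A c where A: "finite A" "f = (\<lambda>x. \<Sum>a\<in>A. c a * monomial a x)"
    using assms unfolding polynomial_fun_def by blast
  have "a i \<le> (\<Sum>a\<in>A. \<Sum>i\<in>UNIV. a i)" if "a \<in> A" for a i
    using member_le_sum[of i UNIV a] member_le_sum[of a A "\<lambda>a. \<Sum>i\<in>UNIV. a i"] A(1) that by simp
  with A show ?thesis
    unfolding has_exponents_def
    by (intro exI[of _ "\<Sum>a\<in>A. \<Sum>i\<in>UNIV. a i"] exI[of _ A] exI[of _ c]) auto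
qed

section \<open>Gradients\<close>

text \<open>The partial derivatives, characterized by the chain rule along curves, since they are used both
  along lines and along the curves \<open>t \<mapsto> (y + t w)\<^sup>n\<close>.\<close>

definition is_gradient ::
    "(complex ^ 'v::finite \<Rightarrow> complex) \<Rightarrow> ('v \<Rightarrow> complex ^ 'v \<Rightarrow> complex) \<Rightarrow> bool" where
  "is_gradient f D \<longleftrightarrow> (\<forall>i. polynomial_fun (D i)) \<and> (\<forall>\<gamma> v.
    (\<forall>i. ((\<lambda>t. \<gamma> t $ i) has_field_derivative v $ i) (at 0)) \<longrightarrow>
    ((\<lambda>t. f (\<gamma> t)) has_field_derivative (\<Sum>i\<in>UNIV. D i (\<gamma> 0) * v $ i)) (at 0))"

lemma polynomial_fun_has_gradient:
  assumes "polynomial_fun f"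
  shows "\<exists>D. is_gradient f D"
  using assms unfolding is_gradient_def
proof (induction rule: polynomial_fun_induct)
  case (const c)
  show ?case by (intro exI[of _ "\<lambda>i x. 0"]) (auto intro: polynomial_fun_const)
next
  case (coord k)
  have "(\<Sum>i\<in>UNIV. (if i = k then 1 else 0) * v $ i) = v $ k" for v :: "complex ^ 'a"
    by (subst sum.cong[OF refl, of _ _ "\<lambda>i. if i = k then v $ i else 0"]) auto
  then show ?case
    by (intro exI[of _ "\<lambda>i x. if i = k then 1 else 0"]) (auto intro: polynomial_fun_const)
next
  case (add f g)
  from add.IH(1) obtain D where D: "\<And>i. polynomial_fun (D i)"
    "\<And>\<gamma> v. (\<forall>i. ((\<lambda>t. \<gamma> t $ i) has_field_derivative v $ i) (at 0)) \<Longrightarrow>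
      ((\<lambda>t. f (\<gamma> t)) has_field_derivative (\<Sum>i\<in>UNIV. D i (\<gamma> 0) * v $ i)) (at 0)"
    by blast
  from add.IH(2) obtain E where E: "\<And>i. polynomial_fun (E i)"
    "\<And>\<gamma> v. (\<forall>i. ((\<lambda>t. \<gamma> t $ i) has_field_derivative v $ i) (at 0)) \<Longrightarrow>
      ((\<lambda>t. g (\<gamma> t)) has_field_derivative (\<Sum>i\<in>UNIV. E i (\<gamma> 0) * v $ i)) (at 0)"
    by blast
  show ?case
  proof (intro exI[of _ "\<lambda>i x. D i x + E i x"] conjI allI impI)
    show "polynomial_fun (\<lambda>x. D i x + E i x)" for i
      by (intro polynomial_fun_add D E)
    fix \<gamma> and v :: "complex ^ 'a"
    assume "\<forall>i. ((\<lambda>t. \<gamma> t $ i) has_field_derivative v $ i) (at 0)"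
    from DERIV_add[OF D(2)[OF this] E(2)[OF this]]
    show "((\<lambda>t. f (\<gamma> t) + g (\<gamma> t)) has_field_derivative
        (\<Sum>i\<in>UNIV. (D i (\<gamma> 0) + E i (\<gamma> 0)) * v $ i)) (at 0)"
      by (simp add: distrib_right sum.distrib)
  qed
next
  case (mult f g)
  from mult.IH(1) obtain D where D: "\<And>i. polynomial_fun (D i)"
    "\<And>\<gamma> v. (\<forall>i. ((\<lambda>t. \<gamma> t $ i) has_field_derivative v $ i) (at 0)) \<Longrightarrow>
      ((\<lambda>t. f (\<gamma> t)) has_field_derivative (\<Sum>i\<in>UNIV. D i (\<gamma> 0) * v $ i)) (at 0)"
    by blast
  from mult.IH(2) obtain E where E: "\<And>i. polynomial_fun (E i)"
    "\<And>\<gamma> v. (\<forall>i. ((\<lambda>t. \<gamma> t $ i) has_field_derivative v $ i) (at 0)) \<Longrightarrow>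
      ((\<lambda>t. g (\<gamma> t)) has_field_derivative (\<Sum>i\<in>UNIV. E i (\<gamma> 0) * v $ i)) (at 0)"
    by blast
  show ?case
  proof (intro exI[of _ "\<lambda>i x. D i x * g x + E i x * f x"] conjI allI impI)
    show "polynomial_fun (\<lambda>x. D i x * g x + E i x * f x)" for i
      by (intro polynomial_fun_add polynomial_fun_mult D E mult.hyps)
    fix \<gamma> and v :: "complex ^ 'a"
    assume "\<forall>i. ((\<lambda>t. \<gamma> t $ i) has_field_derivative v $ i) (at 0)"
    from DERIV_mult[OF D(2)[OF this] E(2)[OF this]]
    show "((\<lambda>t. f (\<gamma> t) * g (\<gamma> t)) has_field_derivative
        (\<Sum>i\<in>UNIV. (D i (\<gamma> 0) * g (\<gamma> 0) + E i (\<gamma> 0) * f (\<gamma> 0)) * v $ i)) (at 0)"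
      by (simp add: algebra_simps sum.distrib sum_distrib_left)
  qed
qed

lemma is_gradient_curve:
  assumes "is_gradient f D" and "\<And>i. ((\<lambda>t. \<gamma> t $ i) has_field_derivative v $ i) (at 0)"
  shows "((\<lambda>t. f (\<gamma> t)) has_field_derivative (\<Sum>i\<in>UNIV. D i (\<gamma> 0) * v $ i)) (at 0)"
  using assms unfolding is_gradient_def by blast

lemma is_gradient_line:
  assumes "is_gradient f D"
  shows "((\<lambda>t. f (x + t *s v)) has_field_derivative (\<Sum>i\<in>UNIV. D i x * v $ i)) (at 0)"
proof -
  have "((\<lambda>t. (x + t *s v) $ i) has_field_derivative v $ i) (at 0)" for i
    by (auto intro!: derivative_eq_intros)
  from is_gradient_curve[OF assms, of "\<lambda>t. x + t *s v", OF this] show ?thesis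
    by simp
qed

section \<open>The polynomials in terms of linear forms in the roots\<close>

definition root_form :: "('m::finite \<Rightarrow> complex) \<Rightarrow> complex ^ 'm option \<Rightarrow> complex" where
  "root_form r y = y $ None + (\<Sum>j\<in>UNIV. r j * y $ Some j)"

definition unity_tuples :: "nat \<Rightarrow> ('m::finite \<Rightarrow> complex) set" where
  "unity_tuples n = {r. \<forall>j. r j ^ n = 1}"

lemma unity_tuples_finite_card:
  assumes "n \<ge> 1"
  shows "finite (unity_tuples n :: ('m::finite \<Rightarrow> complex) set)"
    and "card (unity_tuples n :: ('m \<Rightarrow> complex) set) = n ^ CARD('m)"
proof -
  have eq: "unity_tuples n = PiE (UNIV :: 'm set) (\<lambda>_. {w. w ^ n = 1})"
    by (auto simp: unity_tuples_def PiE_iff)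
  show "finite (unity_tuples n :: ('m \<Rightarrow> complex) set)"
    unfolding eq using assms by (intro finite_PiE finite_roots_unity) auto
  show "card (unity_tuples n :: ('m \<Rightarrow> complex) set) = n ^ CARD('m)"
    unfolding eq using assms by (simp add: card_PiE card_roots_unity_eq)
qed

lemma unity_tuples_nonzero:
  assumes "r \<in> unity_tuples n" "n \<ge> 1"
  shows "r j \<noteq> 0"
proof
  assume "r j = 0"
  moreover have "r j ^ n = 1"
    using assms(1) by (simp add: unity_tuples_def)
  ultimately show False
    using assms(2) by (simp add: power_0_left)
qed

lemma one_in_unity_tuples: "(\<lambda>_. 1) \<in> unity_tuples n"
  by (simp add: unity_tuples_def)

text \<open>The coordinates of \<open>y\<close> themselves serve as the branches of the roots, and each tuple of roots of
  unity is the tuple of powers of the primitive root for exactly one tuple of exponents.\<close>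

lemma p_poly_vpow:
  fixes y :: "complex ^ ('m::finite) option"
  assumes n: "n \<ge> 1"
  shows "p_poly n (vpow n y) = (\<Prod>r\<in>unity_tuples n. root_form r y)"
proof -
  define e where "e = exp (2 * pi * \<i> / of_nat n)"
  define F where "F = PiE (UNIV :: 'm set) (\<lambda>_. {1..n})"
  have e_pow: "e ^ k = exp (2 * of_real pi * \<i> * of_nat k / of_nat n)" for k
    unfolding e_def exp_of_nat_mult[symmetric] by (simp add: field_simps)
  have en: "e ^ n = 1"
    unfolding e_def exp_of_nat_mult[symmetric] using n by simp
  have inj: "inj_on (\<lambda>k. e ^ k) {1..n}"
  proof (rule inj_onI)
    fix k l assume kl: "k \<in> {1..n}" "l \<in> {1..n}" and "e ^ k = e ^ l"
    then have "k mod n = l mod n"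
      using complex_root_unity_eq[OF n] by (simp add: e_pow)
    with kl show "k = l"
      by (cases "k = n"; cases "l = n") auto
  qed
  have "inj_on (\<lambda>k j. e ^ k j) F"
  proof (rule inj_onI, rule ext)
    fix k l j assume kl: "k \<in> F" "l \<in> F" and "(\<lambda>j. e ^ k j) = (\<lambda>j. e ^ l j)"
    then have "e ^ k j = e ^ l j" by meson
    with kl show "k j = l j"
      by (intro inj_onD[OF inj]) (auto simp: F_def)
  qed
  moreover have "(\<lambda>k j. e ^ k j) ` F = unity_tuples n"
  proof (rule card_subset_eq)
    show "(\<lambda>k j. e ^ k j) ` F \<subseteq> unity_tuples n"
    proof -
      have "(e ^ k) ^ n = (e ^ n) ^ k" for k
        by (simp only: power_mult[symmetric] mult.commute)
      then show ?thesis
        by (auto simp: unity_tuples_def en)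
    qed
    show "card ((\<lambda>k j. e ^ k j) ` F) = card (unity_tuples n :: ('m \<Rightarrow> complex) set)"
      using card_image[OF calculation] n by (simp add: F_def card_PiE unity_tuples_finite_card)
  qed (rule unity_tuples_finite_card[OF n])
  ultimately have "(\<Prod>r\<in>unity_tuples n. root_form r y) = (\<Prod>k\<in>F. root_form (\<lambda>j. e ^ k j) y)"
    using prod.reindex[of "\<lambda>k j. e ^ k j" F "\<lambda>r. root_form r y"] by simp
  then show ?thesis
    using p_poly_any_branch[OF n, of "\<lambda>i. y $ i" "vpow n y"]
    by (simp add: root_form_def e_def F_def)
qed

text \<open>The product of the linear forms is homogeneous of degree \<open>n\<^sup>m\<close> and depends only on the \<open>n\<close>-th
  powers of the coordinates; passing to these powers divides the degree by \<open>n\<close>.\<close>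

lemma p_poly_has_exponents:
  assumes n: "n \<ge> 1"
  shows "has_exponents {a. (\<Sum>i\<in>UNIV. a i) = n ^ (CARD('m) - 1)}
    (p_poly n :: complex ^ ('m::finite) option \<Rightarrow> complex)"
proof -
  have coord: "has_exponents {a. (\<Sum>i\<in>UNIV. a i) = 1} (\<lambda>x :: complex ^ 'm option. c * x $ i)" for c i
    using has_exponents_monomial[of "\<lambda>j. if j = i then 1 else 0" "{a. (\<Sum>i\<in>UNIV. a i) = 1}" c]
    unfolding monomial_unit by simp
  have lin: "has_exponents {a. (\<Sum>i\<in>UNIV. a i) = 1} (root_form r)" for r :: "'m \<Rightarrow> complex"
    unfolding root_form_def[abs_def]
    using coord[of 1 None] by (intro has_exponents_add has_exponents_sum coord) simp
  have Q: "has_exponents {a. (\<Sum>i\<in>UNIV. a i) = card T} (\<lambda>y. \<Prod>r\<in>T. root_form r y)"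
    if "finite T" for T :: "('m \<Rightarrow> complex) set"
    using that
  proof induction
    case empty
    show ?case
      using has_exponents_monomial[of "\<lambda>_. 0" "{a. (\<Sum>i\<in>UNIV. a i) = 0}" 1] by simp
  next
    case (insert r T)
    then show ?case
      using has_exponents_mult[OF lin insert.IH, of "{a. (\<Sum>i\<in>UNIV. a i) = card (insert r T)}" r]
      by (simp add: sum.distrib)
  qed
  have inv: "(\<Prod>r\<in>unity_tuples n. root_form r x) = (\<Prod>r\<in>unity_tuples n. root_form r y)"
    if "vpow n x = vpow n y" for x y :: "complex ^ 'm option"
    using that p_poly_vpow[OF n, of x] p_poly_vpow[OF n, of y] by simp
  obtain g where g: "has_exponents {b. (\<Sum>i\<in>UNIV. n * b i) = n ^ CARD('m)} g"
      "\<And>y :: complex ^ 'm option. p_poly n (vpow n y) = g (vpow n y)"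
    using has_exponents_descend[OF n Q[OF unity_tuples_finite_card(1)[OF n]] inv]
    by (auto simp: p_poly_vpow[OF n] unity_tuples_finite_card(2)[OF n])
  have "p_poly n = g"
  proof
    fix x :: "complex ^ 'm option"
    obtain y where "vpow n y = x" using vpow_surj[OF n] by blast
    with g(2)[of y] show "p_poly n x = g x" by simp
  qed
  moreover have "(\<Sum>i\<in>UNIV. n * b i) = n ^ CARD('m) \<longleftrightarrow> (\<Sum>i\<in>UNIV. b i) = n ^ (CARD('m) - 1)"
    for b :: "'m option \<Rightarrow> nat"
  proof -
    have "n ^ CARD('m) = n * n ^ (CARD('m) - 1)"
      by (metis power_minus_mult mult.commute zero_less_card_finite)
    then show ?thesis using n by (simp flip: sum_distrib_left)
  qed
  ultimately show ?thesis using g(1) by simp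
qed

lemma polynomial_fun_p_poly: "n \<ge> 1 \<Longrightarrow> polynomial_fun (p_poly n)"
  using p_poly_has_exponents has_exponents_imp_polynomial_fun by blast

lemma polynomial_fun_root_form: "polynomial_fun (root_form r)"
  unfolding root_form_def[abs_def] by (intro polynomial_fun_intros)

lemma root_form_axis: "root_form r (axis i 1) = (case i of None \<Rightarrow> 1 | Some j \<Rightarrow> r j)"
proof (cases i)
  case (Some k)
  have "(\<Sum>j\<in>UNIV. r j * axis (Some k) 1 $ Some j) = (\<Sum>j\<in>UNIV. if j = k then r j else 0)"
    by (intro sum.cong) (auto simp: axis_def)
  then show ?thesis using Some by (simp add: root_form_def) (simp add: axis_def)
qed (simp add: root_form_def axis_def)

text \<open>The pure power of every variable occurs in \<open>p\<^sub>n\<close>. This is why neither \<open>p\<^sub>n\<close> nor its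
  reciprocal is divisible by a coordinate.\<close>

lemma p_poly_axis:
  assumes "n \<ge> 1"
  shows "p_poly n (axis i 1) \<noteq> 0"
proof -
  have "vpow n (axis i 1) = axis i 1"
    using assms by (auto simp: vec_eq_iff axis_def power_0_left)
  moreover have "root_form r (axis i 1) \<noteq> 0" if "r \<in> unity_tuples n" for r
    using unity_tuples_nonzero[OF that assms] by (simp add: root_form_axis split: option.split)
  ultimately show ?thesis
    using p_poly_vpow[OF assms, of "axis i 1"] by (simp add: unity_tuples_finite_card[OF assms])
qed

text \<open>A vanishing linear form becomes the sum of the coordinates when the roots of unity in it are moved
  into the chosen roots \<open>y\<^sub>j\<close>.\<close>

lemma p_poly_zero_root:
  fixes x :: "complex ^ ('m::finite) option"
  assumes n: "n \<ge> 1" and "p_poly n x = 0"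
  shows "\<exists>y. vpow n y = x \<and> root_form (\<lambda>_. 1) y = 0"
proof -
  obtain y where y: "vpow n y = x" using vpow_surj[OF n] by blast
  with assms obtain r where r: "r \<in> unity_tuples n" "root_form r y = 0"
    using p_poly_vpow[OF n, of y] by (auto simp: unity_tuples_finite_card[OF n])
  let ?y = "\<chi> i. case i of None \<Rightarrow> y $ None | Some j \<Rightarrow> r j * y $ Some j"
  have "vpow n ?y = x"
    using y r(1) by (auto simp: vec_eq_iff power_mult_distrib unity_tuples_def split: option.split)
  moreover have "root_form (\<lambda>_. 1) ?y = 0"
    using r(2) by (simp add: root_form_def)
  ultimately show ?thesis by blast
qed

lemma p_poly_vpow_eq_0:
  assumes "n \<ge> 1" "r \<in> unity_tuples n" "root_form r y = 0"
  shows "p_poly n (vpow n y) = 0"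
  using assms by (auto simp: p_poly_vpow unity_tuples_finite_card)

section \<open>The ideal of the hypersurface\<close>

text \<open>The projection onto the hyperplane \<open>root_form r = 0\<close> along the axis of \<open>None\<close>. Composition with it
  identifies the functions on the hyperplane with an integral domain of polynomial functions.\<close>

definition hyperplane_point :: "('m::finite \<Rightarrow> complex) \<Rightarrow> complex ^ 'm option \<Rightarrow> complex ^ 'm option" where
  "hyperplane_point r y = (\<chi> i. if i = None then - (\<Sum>j\<in>UNIV. r j * y $ Some j) else y $ i)"

lemma root_form_hyperplane_point:
  "root_form s (hyperplane_point r y) = (\<Sum>j\<in>UNIV. (s j - r j) * y $ Some j)"
  by (simp add: root_form_def hyperplane_point_def left_diff_distrib sum_subtractf)

lemma hyperplane_point_id: "root_form r y = 0 \<Longrightarrow> hyperplane_point r y = y"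
  by (simp add: root_form_def hyperplane_point_def vec_eq_iff neg_eq_iff_add_eq_0 add.commute)

lemma polynomial_fun_hyperplane_point:
  assumes "polynomial_fun f"
  shows "polynomial_fun (\<lambda>y. f (hyperplane_point r y))"
  unfolding hyperplane_point_def
proof (rule polynomial_fun_subst[OF assms])
  show "polynomial_fun (\<lambda>y. if i = None then - (\<Sum>j\<in>UNIV. r j * y $ Some j) else y $ i)" for i
  proof (cases i)
    case None
    have "polynomial_fun (\<lambda>y :: complex ^ 'a option. \<Sum>j\<in>UNIV. - r j * y $ Some j)"
      by (intro polynomial_fun_intros)
    with None show ?thesis by (simp add: sum_negf)
  qed (simp add: polynomial_fun_coord)
qed

lemma root_form_factor:
  assumes "polynomial_fun f" and 0: "\<And>y. root_form r y = 0 \<Longrightarrow> f y = 0"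
  shows "\<exists>g. polynomial_fun g \<and> (\<forall>y. f y = root_form r y * g y)"
proof -
  let ?w = "\<lambda>y. (\<Sum>j\<in>UNIV. - r j * y $ Some j)"
  have "polynomial_fun ?w" by (intro polynomial_fun_intros)
  from polynomial_fun_split_factor[OF assms(1) this, of None]
  obtain g where g: "polynomial_fun g"
    "\<And>y. f y - f (\<chi> j. if j = None then ?w y else y $ j) = (y $ None - ?w y) * g y" by blast
  moreover have "f (\<chi> j. if j = None then ?w y else y $ j) = 0" for y
    by (rule 0) (simp add: root_form_def sum_negf)
  ultimately show ?thesis
    by (intro exI[of _ g]) (simp add: root_form_def sum_negf)
qed

text \<open>Vanishing on a hyperplane may be checked at its general points: the coordinates and
  the other linear forms do not vanish identically on it, so they can be cancelled there.\<close>

lemma root_form_generic: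
  fixes r :: "'m::finite \<Rightarrow> complex"
  assumes "polynomial_fun f" "finite S" "r \<notin> S" and r: "root_form r y = 0" "\<And>j. r j \<noteq> 0"
    and 0: "\<And>y. root_form r y = 0 \<Longrightarrow> y \<in> torus \<Longrightarrow> (\<And>s. s \<in> S \<Longrightarrow> root_form s y \<noteq> 0) \<Longrightarrow> f y = 0"
  shows "f y = 0"
proof -
  let ?h = "hyperplane_point r"
  let ?P = "\<lambda>y. (\<Prod>i\<in>UNIV. ?h y $ i)"
  let ?R = "\<lambda>y. (\<Prod>s\<in>S. root_form s (?h y))"
  have ri: "root_form r (?h y) = 0" for y
    by (simp add: root_form_hyperplane_point)
  have coord: "polynomial_fun (\<lambda>y. ?h y $ i)" for i
    by (rule polynomial_fun_hyperplane_point) (rule polynomial_fun_coord)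
  have factor: "polynomial_fun (\<lambda>y. root_form s (?h y))" for s
    by (rule polynomial_fun_hyperplane_point) (rule polynomial_fun_root_form)
  have poly: "polynomial_fun (\<lambda>y. f (?h y))"
    by (rule polynomial_fun_hyperplane_point) (rule assms)
  have "\<exists>y. ?P y \<noteq> 0"
  proof (rule polynomial_fun_prod_nonzero)
    show "\<exists>y. ?h y $ i \<noteq> 0" for i
    proof (cases i)
      case None
      have "?h (axis (Some j) 1) $ None = - r j" for j
        using root_form_axis[of r "Some j"] by (simp add: root_form_def hyperplane_point_def axis_def)
      then show ?thesis using None r(2) by (metis neg_equal_0_iff_equal)
    next
      case (Some j)
      then show ?thesis by (intro exI[of _ "vec 1"]) (simp add: hyperplane_point_def)
    qed
  qed (simp_all add: coord)
  then obtain a where a: "?P a \<noteq> 0" ..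
  have "\<exists>y. ?R y \<noteq> 0"
  proof (rule polynomial_fun_prod_nonzero[OF \<open>finite S\<close> factor])
    fix s assume "s \<in> S"
    with \<open>r \<notin> S\<close> have "s \<noteq> r" by blast
    then obtain j where j: "s j \<noteq> r j" by blast
    have "root_form s (?h (axis (Some j) 1)) = s j - r j"
      using root_form_axis[of "\<lambda>j. s j - r j" "Some j"]
      unfolding root_form_hyperplane_point by (simp add: root_form_def axis_def)
    then show "\<exists>y. root_form s (?h y) \<noteq> 0"
      using j by (intro exI[of _ "axis (Some j) 1"]) simp
  qed
  then obtain b where b: "?R b \<noteq> 0" ..
  have "?R y * f (?h y) = 0" for y
  proof -
    have "(\<lambda>y. ?R y * f (?h y)) = (\<lambda>y. 0)"
    proof (rule polynomial_fun_zero_divisor[where f = ?P and a = a])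
      show "?P y * (?R y * f (?h y)) = 0" for y
        using 0[OF ri, of y] \<open>finite S\<close> by (auto simp: torus_def)
    qed (use a in \<open>auto intro!: polynomial_fun_mult polynomial_fun_prod coord factor poly\<close>)
    then show ?thesis by meson
  qed
  then have "(\<lambda>y. f (?h y)) = (\<lambda>y. 0)"
    using b by (intro polynomial_fun_zero_divisor[where f = ?R and a = b])
      (auto intro!: polynomial_fun_prod factor poly)
  then show ?thesis
    using hyperplane_point_id[OF r(1)] by metis
qed

text \<open>The quotient of \<open>f(y\<^sup>n)\<close> by the linear forms is built up one form at a time: what remains after
  the forms in \<open>S\<close> still vanishes at the points of the next hyperplane that lie on none of the
  hyperplanes of \<open>S\<close>, hence on the whole of it. The final quotient \<open>h\<close> descends along \<open>y \<mapsto> y\<^sup>n\<close>.\<close>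

lemma p_poly_dvd:
  fixes f :: "complex ^ ('m::finite) option \<Rightarrow> complex"
  assumes n: "n \<ge> 1" and f: "polynomial_fun f"
    and 0: "\<And>x. x \<in> torus \<Longrightarrow> p_poly n x = 0 \<Longrightarrow> f x = 0"
  shows "\<exists>g. polynomial_fun g \<and> f = (\<lambda>x. p_poly n x * g x)"
proof -
  let ?T = "unity_tuples n :: ('m \<Rightarrow> complex) set"
  let ?F = "\<lambda>y. f (vpow n y)"
  let ?Q = "\<lambda>y. \<Prod>r\<in>?T. root_form r y"
  have polyF: "polynomial_fun ?F"
    unfolding vpow_def by (intro polynomial_fun_subst[OF f] polynomial_fun_intros)
  have r0: "r j \<noteq> 0" if "r \<in> ?T" for r j
    using unity_tuples_nonzero[OF that n] .
  have F0: "?F y = 0" if r: "r \<in> ?T" and "root_form r y = 0" for r y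
  proof (rule root_form_generic[OF polyF _ _ that(2), of "{}"])
    fix y assume "root_form r y = 0" "y \<in> torus"
    with r show "?F y = 0"
      by (intro 0 p_poly_vpow_eq_0[OF n r]) (auto simp: torus_def)
  qed (use r0[OF r] in auto)
  have "\<exists>h. polynomial_fun h \<and> (\<forall>y. ?F y = (\<Prod>r\<in>S. root_form r y) * h y)"
    if "finite S" "S \<subseteq> ?T" for S
    using that
  proof (induction S)
    case empty
    then show ?case using polyF by auto
  next
    case (insert r S)
    then obtain h where h: "polynomial_fun h" "\<And>y. ?F y = (\<Prod>r\<in>S. root_form r y) * h y"
      by auto
    have r: "r \<in> ?T" using insert by auto
    have "h y = 0" if "root_form r y = 0" for y
    proof (rule root_form_generic[OF h(1) insert.hyps that])
      fix y assume "root_form r y = 0" "\<And>s. s \<in> S \<Longrightarrow> root_form s y \<noteq> 0"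
      then show "h y = 0"
        using F0[OF r] h(2)[of y] insert.hyps by simp
    qed (use r0[OF r] in auto)
    from root_form_factor[OF h(1) this]
    obtain g where "polynomial_fun g" "\<And>y. h y = root_form r y * g y" by blast
    then show ?case
      using insert.hyps h(2) by (intro exI[of _ g]) (simp add: mult_ac)
  qed
  from this[OF unity_tuples_finite_card(1)[OF n] order_refl]
  obtain h where h: "polynomial_fun h" "\<And>y. ?F y = ?Q y * h y"
    by blast
  have inv: "h x = h y" if xy: "vpow n x = vpow n y" for x y
  proof -
    \<comment> \<open>The value \<open>1\<close> is arbitrary: if \<open>y $ i = 0\<close>, then \<open>x $ i = 0\<close>, and any root of unity will do.\<close>
    define \<zeta> where "\<zeta> i = (if y $ i = 0 then 1 else x $ i / y $ i)" for i
    have xn: "x $ i ^ n = y $ i ^ n" for i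
      using xy by (simp add: vec_eq_iff)
    have \<zeta>: "\<zeta> i ^ n = 1" "\<zeta> i * y $ i = x $ i" for i
      using xn[of i] n by (auto simp: \<zeta>_def power_divide power_0_left)
    let ?s = "\<lambda>z. \<chi> i. \<zeta> i * z $ i"
    have s: "vpow n (?s z) = vpow n z" for z
      by (simp add: vec_eq_iff power_mult_distrib \<zeta>)
    have "(\<lambda>z. h (?s z) - h z) = (\<lambda>z. 0)"
    proof (rule polynomial_fun_zero_divisor)
      show "polynomial_fun ?Q"
        by (intro polynomial_fun_prod polynomial_fun_root_form)
      show "polynomial_fun (\<lambda>z. h (?s z) - h z)"
        by (intro polynomial_fun_diff h(1) polynomial_fun_subst[OF h(1)] polynomial_fun_intros)
      show "?Q z * (h (?s z) - h z) = 0" for z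
        using h(2)[of z] h(2)[of "?s z"] s[of z] p_poly_vpow[OF n, of z] p_poly_vpow[OF n, of "?s z"]
        by (auto simp: right_diff_distrib)
      show "?Q (axis None 1) \<noteq> 0"
        by (simp add: root_form_axis)
    qed
    moreover have "?s y = x" by (simp add: vec_eq_iff \<zeta>)
    ultimately show ?thesis by (metis eq_iff_diff_eq_0)
  qed
  obtain g where g: "polynomial_fun g" "\<And>y. h y = g (vpow n y)"
    using has_exponents_descend[OF n h(1)[unfolded polynomial_fun_iff_has_exponents] inv]
      has_exponents_imp_polynomial_fun by blast
  have "f x = p_poly n x * g x" for x
  proof -
    obtain y where "vpow n y = x" using vpow_surj[OF n] by blast
    then show ?thesis using h(2)[of y] g(2)[of y] p_poly_vpow[OF n, of y] by simp
  qed
  with g(1) show ?thesis by blast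
qed

text \<open>Differentiate \<open>p\<^sub>n((y + t e\<^sub>i)\<^sup>n)\<close> at \<open>t = 0\<close> in two ways. On the one hand this is the chain rule;
  on the other hand the factor \<open>\<Sum>\<^sub>k y\<^sub>k\<close> of the product becomes \<open>t\<close>, so the derivative is
  the product of the remaining factors.\<close>

lemma p_poly_gradient:
  fixes y :: "complex ^ ('m::finite) option"
  assumes n: "n \<ge> 1" and D: "is_gradient (p_poly n) D" and y: "root_form (\<lambda>_. 1) y = 0"
  shows "D i (vpow n y) * (of_nat n * y $ i ^ (n - 1)) =
    (\<Prod>r\<in>unity_tuples n - {\<lambda>_. 1}. root_form r y)"
proof -
  let ?R = "\<lambda>y :: complex ^ 'm option. \<Prod>r\<in>unity_tuples n - {\<lambda>_. 1}. root_form r y"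
  let ?l = "\<lambda>t. y + t *s axis i 1"
  let ?v = "\<chi> k. of_nat n * y $ k ^ (n - 1) * axis i 1 $ k"
  have "((\<lambda>t. vpow n (?l t) $ k) has_field_derivative ?v $ k) (at 0)" for k
    by (auto intro!: derivative_eq_intros)
  from is_gradient_curve[OF D, of "\<lambda>t. vpow n (?l t)", OF this] have "((\<lambda>t. p_poly n (vpow n (?l t))) has_field_derivative
      (\<Sum>k\<in>UNIV. D k (vpow n (?l 0)) * ?v $ k)) (at 0)"
    .
  moreover have "(\<Sum>k\<in>UNIV. D k (vpow n (?l 0)) * ?v $ k) =
      (\<Sum>k\<in>UNIV. if k = i then D k (vpow n y) * (of_nat n * y $ k ^ (n - 1)) else 0)"
    by (intro sum.cong) (auto simp: axis_def)
  moreover have "p_poly n (vpow n (?l t)) = t * ?R (?l t)" for t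
  proof -
    have "root_form (\<lambda>_. 1) (?l t) = root_form (\<lambda>_. 1) y + t * root_form (\<lambda>_. 1) (axis i 1)"
      by (simp add: root_form_def sum.distrib sum_distrib_left distrib_left)
    also have "\<dots> = t"
      using y by (simp add: root_form_axis split: option.split)
    finally show ?thesis
      unfolding p_poly_vpow[OF n]
      by (subst prod.remove[OF unity_tuples_finite_card(1)[OF n] one_in_unity_tuples]) simp
  qed
  ultimately have "((\<lambda>t. t * ?R (?l t)) has_field_derivative
      D i (vpow n y) * (of_nat n * y $ i ^ (n - 1))) (at 0)"
    by simp
  moreover have "polynomial_fun ?R"
    by (intro polynomial_fun_prod polynomial_fun_root_form)
  then obtain E where "is_gradient ?R E"
    using polynomial_fun_has_gradient by blast
  from DERIV_mult[OF DERIV_ident is_gradient_line[OF this, of y "axis i 1"]]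
  have "((\<lambda>t. t * ?R (?l t)) has_field_derivative ?R y) (at 0)"
    by simp
  ultimately show ?thesis
    by (rule DERIV_unique)
qed

text \<open>At a general point of the hyperplane the product of the remaining linear forms does not vanish,
  so the gradient is nonzero.\<close>

lemma p_poly_gradient_generic:
  fixes y :: "complex ^ ('m::finite) option"
  assumes n: "n \<ge> 1" and D: "is_gradient (p_poly n) D"
    and y: "root_form (\<lambda>_. 1) y = 0" "y \<in> torus"
    and s: "\<And>s. s \<in> unity_tuples n - {\<lambda>_. 1} \<Longrightarrow> root_form s y \<noteq> 0"
  shows "\<exists>c. c \<noteq> 0 \<and> (\<chi> i. D i (vpow n y)) = c *s vinverse (vpow (n - 1) y)"
proof (intro exI conjI)
  let ?R = "\<Prod>r\<in>unity_tuples n - {\<lambda>_. 1}. root_form r y"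
  show "?R / of_nat n \<noteq> 0"
    using n s unity_tuples_finite_card(1)[OF n, where 'm = 'm] by simp
  show "(\<chi> i. D i (vpow n y)) = (?R / of_nat n) *s vinverse (vpow (n - 1) y)"
    using p_poly_gradient[OF n D y(1)] y(2) n
    by (simp add: vec_eq_iff torus_def vinverse_def field_simps)
qed

section \<open>Hypersurfaces in projective space and their tangent hyperplanes\<close>

lemma abs_cproj_eq_imp_scale:
  assumes "abs_cproj u = abs_cproj v" "u \<noteq> 0" "v \<noteq> 0"
  shows "\<exists>c. u = c *s v"
proof -
  have refl: "proportional w w" if "w \<noteq> 0" for w :: "complex ^ 'a"
    unfolding proportional_def using that by (metis vec.scale_one)
  have "proportional u v"
    using Quotient3_rel[OF Quotient3_cproj, of u v] assms refl by blast
  then show ?thesis by (simp add: proportional_def)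
qed

lemma mem_zero_locus:
  assumes "form f" "v \<noteq> 0"
  shows "abs_cproj v \<in> zero_locus f \<longleftrightarrow> f v = 0"
proof
  assume "abs_cproj v \<in> zero_locus f"
  then obtain u where u: "abs_cproj v = abs_cproj u" "u \<noteq> 0" "f u = 0"
    unfolding zero_locus_def by blast
  then show "f v = 0"
    using abs_cproj_eq_imp_scale[OF u(1) assms(2) u(2)] form_scale_zero[OF assms(1)] by auto
qed (use assms in \<open>auto simp: zero_locus_def\<close>)

text \<open>Every set of points to which this is applied is a parametrized one, and a form may be
  tested on any representatives.\<close>

lemma vanishing_forms_points:
  "vanishing_forms {abs_cproj (\<phi> u) | u. R u \<and> \<phi> u \<noteq> 0} = {f. form f \<and> (\<forall>u. R u \<longrightarrow> \<phi> u \<noteq> 0 \<longrightarrow> f (\<phi> u) = 0)}"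
  unfolding vanishing_forms_def
proof (intro Collect_cong conj_cong refl iffI allI impI)
  fix f v
  assume f: "form f" and 0: "\<forall>u. R u \<longrightarrow> \<phi> u \<noteq> 0 \<longrightarrow> f (\<phi> u) = 0" and "v \<noteq> 0"
    and "abs_cproj v \<in> {abs_cproj (\<phi> u) |u. R u \<and> \<phi> u \<noteq> 0}"
  then obtain u where "abs_cproj v = abs_cproj (\<phi> u)" "R u" "\<phi> u \<noteq> 0" by blast
  with abs_cproj_eq_imp_scale[OF this(1) \<open>v \<noteq> 0\<close> this(3)] form_scale_zero[OF f] 0
  show "f v = 0" by auto
qed auto

text \<open>If the homogeneous ideal of a set of points is generated by \<open>q\<close>, then the closure is the
  hypersurface of \<open>q\<close>, with the same ideal. The dual variety and the
  image under the inversion are determined in this way from the forms that vanish on a dense part.\<close>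

lemma principal_zariski_closure:
  assumes q: "form q"
    and S: "vanishing_forms S = {f. form f \<and> (\<exists>g. polynomial_fun g \<and> f = (\<lambda>x. q x * g x))}"
  shows "zariski_closure S = zero_locus q" and "defining_polynomial (zariski_closure S) q"
proof -
  have qS: "q \<in> vanishing_forms S"
    unfolding S using q by (auto intro: exI[of _ "\<lambda>_. 1"] polynomial_fun_const)
  show closure: "zariski_closure S = zero_locus q"
    unfolding zariski_closure_def
  proof (rule antisym)
    show "\<Inter> (zero_locus ` vanishing_forms S) \<subseteq> zero_locus q"
      using qS by blast
    show "zero_locus q \<subseteq> \<Inter> (zero_locus ` vanishing_forms S)"
      unfolding S by (auto simp: zero_locus_def)
  qed
  have "vanishing_forms (zero_locus q) = vanishing_forms S"
  proof (intro set_eqI iffI)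
    fix f assume "f \<in> vanishing_forms (zero_locus q)"
    then show "f \<in> vanishing_forms S"
      using qS mem_zero_locus[OF q] unfolding vanishing_forms_def by blast
  next
    fix f assume "f \<in> vanishing_forms S"
    then show "f \<in> vanishing_forms (zero_locus q)"
      using mem_zero_locus[OF q] unfolding S by (auto simp: vanishing_forms_def)
  qed
  then show "defining_polynomial (zariski_closure S) q"
    unfolding defining_polynomial_def closure S using q by simp
qed

lemma defining_polynomial_vanishes:
  assumes "defining_polynomial X q"
  shows "q \<in> vanishing_forms X"
proof -
  have "\<exists>g. polynomial_fun g \<and> q = (\<lambda>x. q x * g x)"
    by (intro exI[of _ "\<lambda>_. 1"]) (simp add: polynomial_fun_const)
  with assms show ?thesis
    unfolding defining_polynomial_def by blast
qed

lemma defining_polynomial_cmult: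
  assumes "defining_polynomial X q" "c \<noteq> 0"
  shows "defining_polynomial X (\<lambda>x. c * q x)"
proof -
  have "(\<exists>g. polynomial_fun g \<and> f = (\<lambda>x. q x * g x)) \<longleftrightarrow>
      (\<exists>g. polynomial_fun g \<and> f = (\<lambda>x. c * q x * g x))" for f
  proof
    assume "\<exists>g. polynomial_fun g \<and> f = (\<lambda>x. q x * g x)"
    then obtain g where "polynomial_fun g" "f = (\<lambda>x. q x * g x)" by blast
    with \<open>c \<noteq> 0\<close> show "\<exists>g. polynomial_fun g \<and> f = (\<lambda>x. c * q x * g x)"
      by (intro exI[of _ "\<lambda>x. inverse c * g x"]) (auto intro: polynomial_fun_intros)
  next
    assume "\<exists>g. polynomial_fun g \<and> f = (\<lambda>x. c * q x * g x)"
    then obtain g where "polynomial_fun g" "f = (\<lambda>x. c * q x * g x)" by blast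
    then show "\<exists>g. polynomial_fun g \<and> f = (\<lambda>x. q x * g x)"
      by (intro exI[of _ "\<lambda>x. c * g x"]) (auto intro: polynomial_fun_intros)
  qed
  moreover have "zero_locus (\<lambda>x. c * q x) = zero_locus q"
    using \<open>c \<noteq> 0\<close> by (simp add: zero_locus_def)
  ultimately show ?thesis
    using assms(1) unfolding defining_polynomial_def by (auto simp only: form_cmult)
qed

text \<open>Two generators divide each other, and the only units are the constants. The point \<open>a\<close> excludes the
  zero polynomial.\<close>

lemma defining_polynomial_unique:
  assumes q: "defining_polynomial X q" and q': "defining_polynomial X q'" and "q' a \<noteq> 0"
  shows "\<exists>c. c \<noteq> 0 \<and> q = (\<lambda>x. c * q' x)"
proof -
  obtain g where g: "polynomial_fun g" "q = (\<lambda>x. q' x * g x)"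
    using defining_polynomial_vanishes[OF q] q' unfolding defining_polynomial_def by blast
  obtain g' where g': "polynomial_fun g'" "q' = (\<lambda>x. q x * g' x)"
    using defining_polynomial_vanishes[OF q'] q unfolding defining_polynomial_def by blast
  have eq: "q' x * (g x * g' x - 1) = 0" for x
    using fun_cong[OF g(2), of x] fun_cong[OF g'(2), of x] by (simp add: algebra_simps)
  have "polynomial_fun q'"
    using q' by (simp add: defining_polynomial_def form_polynomial_fun)
  moreover have "polynomial_fun (\<lambda>x. g x * g' x - 1)"
    by (intro polynomial_fun_intros g(1) g'(1))
  ultimately have "(\<lambda>x. g x * g' x - 1) = (\<lambda>x. 0)"
    using eq \<open>q' a \<noteq> 0\<close> by (intro polynomial_fun_zero_divisor[where f = q' and a = a])
  then have "g x * g' x = 1" for x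
    by (metis eq_iff_diff_eq_0)
  from polynomial_fun_unit_const[OF g(1) g'(1) this] obtain c where "c \<noteq> 0" "g = (\<lambda>x. c)"
    by blast
  with g(2) show ?thesis by (auto simp: mult.commute)
qed

text \<open>The differentials at \<open>x\<close> of the multiples of \<open>q\<close> are multiples of the differential of \<open>q\<close>,
  because \<open>q\<close> vanishes at \<open>x\<close>.\<close>

lemma tangent_space_hypersurface:
  assumes X: "defining_polynomial X q" and D: "is_gradient q D" and x: "q x = 0"
  shows "tangent_space X x = hyperplane (\<chi> i. D i x)"
proof -
  have dq: "deriv (\<lambda>t. q (x + t *s v)) 0 = (\<Sum>i\<in>UNIV. D i x * v $ i)" for v
    by (rule DERIV_imp_deriv[OF is_gradient_line[OF D]])
  have qX: "q \<in> vanishing_forms X"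
    by (rule defining_polynomial_vanishes[OF X])
  have "deriv (\<lambda>t. f (x + t *s v)) 0 = 0"
    if f: "f \<in> vanishing_forms X" and 0: "(\<Sum>i\<in>UNIV. D i x * v $ i) = 0" for f v
  proof -
    obtain g where g: "polynomial_fun g" "f = (\<lambda>x. q x * g x)"
      using f X unfolding defining_polynomial_def by blast
    obtain E where "is_gradient g E"
      using polynomial_fun_has_gradient[OF g(1)] by blast
    from DERIV_mult[OF is_gradient_line[OF D, of x v] is_gradient_line[OF this, of x v]]
    have "((\<lambda>t. q (x + t *s v) * g (x + t *s v)) has_field_derivative 0) (at 0)"
      using x 0 by simp
    then show ?thesis
      unfolding g(2) by (rule DERIV_imp_deriv)
  qed
  then show ?thesis
    using qX dq by (auto simp: tangent_space_def hyperplane_def scalar_product_def)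
qed

lemma scalar_product_axis: "scalar_product a (axis i 1) = (a :: complex ^ 'v::finite) $ i"
proof -
  have "scalar_product a (axis i 1) = (\<Sum>j\<in>UNIV. if j = i then a $ j else 0)"
    unfolding scalar_product_def by (intro sum.cong) (auto simp: axis_def)
  then show ?thesis by simp
qed

lemma scalar_product_linear:
  "scalar_product a (v + c *s w) = scalar_product a v + c * scalar_product (a :: complex ^ 'v::finite) w"
  by (simp add: scalar_product_def sum.distrib sum_distrib_left distrib_left mult.left_commute)

lemma hyperplane_dim:
  fixes a :: "complex ^ 'v::finite"
  assumes "a \<noteq> 0"
  shows "vec.dim (hyperplane a) = CARD('v) - 1"
proof -
  obtain i where i: "a $ i \<noteq> 0"
    using assms by (auto simp: vec_eq_iff)
  let ?H = "hyperplane a"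
  have sub: "vec.subspace ?H"
    unfolding vec.subspace_def hyperplane_def
    using scalar_product_linear[of a _ 1] scalar_product_linear[of a 0]
    by (auto simp: scalar_product_def[of a 0])
  then have "axis i 1 \<notin> vec.span ?H"
    using i by (simp add: vec.span_eq_iff[THEN iffD2] hyperplane_def scalar_product_axis)
  then have "vec.dim (insert (axis i 1) ?H) = vec.dim ?H + 1"
    by (simp add: vec.dim_insert)
  moreover have "v \<in> vec.span (insert (axis i 1) ?H)" for v
  proof -
    let ?c = "scalar_product a v / a $ i"
    have "v + (- ?c) *s axis i 1 \<in> ?H"
      using i by (simp only: hyperplane_def mem_Collect_eq scalar_product_linear scalar_product_axis) simp
    then have "(v + (- ?c) *s axis i 1) + ?c *s axis i 1 \<in> vec.span (insert (axis i 1) ?H)"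
      by (intro vec.span_add vec.span_scale vec.span_base) auto
    moreover have "(v + (- ?c) *s axis i 1) + ?c *s axis i 1 = v"
      by (simp add: vec_eq_iff)
    ultimately show ?thesis by simp
  qed
  then have "vec.span (insert (axis i 1) ?H) = UNIV" by blast
  then have "vec.dim (insert (axis i 1) ?H) = CARD('v)"
    by (metis vec.dim_span vec_dim_card)
  ultimately show ?thesis by simp
qed

lemma hyperplane_subset_imp_scale:
  fixes a u :: "complex ^ 'v::finite"
  assumes sub: "hyperplane a \<subseteq> hyperplane u" and "u \<noteq> 0"
  shows "\<exists>c. u = c *s a"
proof (cases "a = 0")
  case True
  then have "scalar_product u (axis i 1) = 0" for i
    using sub by (auto simp: hyperplane_def scalar_product_def)
  with \<open>u \<noteq> 0\<close> show ?thesis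
    by (simp add: scalar_product_axis vec_eq_iff)
next
  case False
  then obtain i where i: "a $ i \<noteq> 0"
    by (auto simp: vec_eq_iff)
  have "u $ j = u $ i / a $ i * a $ j" for j
  proof -
    have "axis j 1 + (- (a $ j / a $ i)) *s axis i 1 \<in> hyperplane a"
      unfolding hyperplane_def mem_Collect_eq scalar_product_linear scalar_product_axis using i by simp
    then have "axis j 1 + (- (a $ j / a $ i)) *s axis i 1 \<in> hyperplane u"
      using sub by blast
    then show ?thesis
      unfolding hyperplane_def mem_Collect_eq scalar_product_linear scalar_product_axis
      by (simp add: field_simps)
  qed
  then have "u = (u $ i / a $ i) *s a"
    unfolding vec_eq_iff vector_smult_component by blast
  then show ?thesis
    by (rule exI)
qed

section \<open>Reciprocal polynomials\<close>

lemma is_reciprocal_unique: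
  assumes "is_reciprocal d f g" "is_reciprocal d f h"
  shows "g = h"
  using assms unfolding is_reciprocal_def by (intro polynomial_fun_eqI_torus) auto

lemma is_reciprocal_reciprocal: "is_reciprocal d f g \<Longrightarrow> reciprocal d f = g"
  unfolding reciprocal_def by (rule the_equality) (auto intro: is_reciprocal_unique)

text \<open>The exponents of a form of degree \<open>d\<close> are at most \<open>d\<close>, so \<open>(\<Prod>\<^sub>i x\<^sub>i)\<^sup>d\<close> clears all denominators.\<close>

lemma form_reciprocal_exists:
  fixes f :: "complex ^ 'v::finite \<Rightarrow> complex"
  assumes "form_of_degree d f"
  shows "\<exists>g. is_reciprocal d f g \<and> form g"
proof -
  let ?S = "{a :: 'v \<Rightarrow> nat. (\<Sum>i\<in>UNIV. a i) = d}"
  have le: "a i \<le> d" if "a \<in> ?S" for a i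
    using that member_le_sum[of i UNIV a] by simp
  obtain g where g: "has_exponents ((\<lambda>a i. d - a i) ` ?S) g"
    "\<forall>x\<in>torus. g x = (\<Prod>i\<in>UNIV. x $ i) ^ d * f (vinverse x)"
    using has_exponents_reverse[OF assms[unfolded form_of_degree_iff_has_exponents], of d] le by blast
  have "(\<Sum>i\<in>UNIV. d - a i) = CARD('v) * d - d" if "a \<in> ?S" for a
    using that le[OF that] by (simp add: sum_subtractf_nat)
  then have "(\<lambda>a i. d - a i) ` ?S \<subseteq> {b. (\<Sum>i\<in>UNIV. b i) = CARD('v) * d - d}"
    by auto
  from has_exponents_mono[OF g(1) this] have "form g"
    unfolding form_def form_of_degree_iff_has_exponents by blast
  with g(2) show ?thesis
    by (auto simp: is_reciprocal_def dest: form_polynomial_fun)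
qed

lemma p_poly_form_of_degree:
  "n \<ge> 1 \<Longrightarrow> form_of_degree (n ^ (CARD('m) - 1)) (p_poly n :: complex ^ ('m::finite) option \<Rightarrow> complex)"
  unfolding form_of_degree_iff_has_exponents by (rule p_poly_has_exponents)

lemma form_p_poly: "n \<ge> 1 \<Longrightarrow> form (p_poly n)"
  unfolding form_def using p_poly_form_of_degree by blast

text \<open>At the point with the coordinate \<open>t\<close> at \<open>i\<close> and \<open>1\<close> elsewhere, homogeneity gives
  \<open>P(1, \<dots>, t, \<dots>, 1) = p(t, \<dots>, 1, \<dots>, t)\<close> for \<open>t \<noteq> 0\<close>, hence also for \<open>t = 0\<close>, where the right
  hand side is the value at a coordinate axis.\<close>

lemma reciprocal_p_poly_coordinate:
  fixes P :: "complex ^ ('m::finite) option \<Rightarrow> complex"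
  assumes n: "n \<ge> 1" and P: "is_reciprocal (n ^ (CARD('m) - 1)) (p_poly n) P"
  shows "\<exists>x. x $ i = 0 \<and> P x \<noteq> 0"
proof -
  let ?d = "n ^ (CARD('m) - 1)"
  let ?a = "(\<chi> j. if j = i then 0 else 1) :: complex ^ 'm option"
  obtain q where q: "\<And>t. P (?a + t *s axis i 1) = poly q t"
    using polynomial_fun_on_line P unfolding is_reciprocal_def by metis
  obtain r where r: "\<And>t. p_poly n (axis i 1 + t *s ?a) = poly r t"
    using polynomial_fun_on_line polynomial_fun_p_poly[OF n] by metis
  have "poly q t = poly r t" if "t \<noteq> 0" for t
  proof -
    let ?x = "?a + t *s axis i 1"
    have x: "?x $ j = (if j = i then t else 1)" for j
      by (simp add: axis_def)
    have "vinverse ?x = inverse t *s (axis i 1 + t *s ?a)"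
      using that by (auto simp: vec_eq_iff vinverse_def axis_def)
    moreover have "?x \<in> torus" "(\<Prod>j\<in>UNIV. ?x $ j) = t"
      using that unfolding torus_def mem_Collect_eq x by simp_all
    ultimately have "P ?x = t ^ ?d * p_poly n (inverse t *s (axis i 1 + t *s ?a))"
      using P by (metis is_reciprocal_def)
    also have "\<dots> = p_poly n (axis i 1 + t *s ?a)"
      unfolding form_of_degree_scale[OF p_poly_form_of_degree[OF n]] using that by (simp add: power_inverse)
    finally show ?thesis
      unfolding q r .
  qed
  then have "poly ([:0, 1:] * (q - r)) = poly 0"
    by (auto simp: fun_eq_iff)
  then have "[:0, 1:] * (q - r) = 0"
    by (simp only: poly_eq_poly_eq_iff)
  then have "q = r" by simp
  then have "P ?a = p_poly n (axis i 1)"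
    using q[of 0] r[of 0] by simp
  then show ?thesis
    using p_poly_axis[OF n] by (intro exI[of _ ?a]) simp
qed

text \<open>Inversion turns \<open>f\<close> into a polynomial \<open>g\<close> that vanishes on the hypersurface of \<open>p\<^sub>n\<close>, so
  \<open>g = p\<^sub>n k\<close>. Inverting \<open>k\<close> back gives \<open>f = P k\<close> up to powers of the coordinates, which can
  be cancelled because no coordinate divides \<open>P\<close>. The finite set \<open>S\<close> restricts the hypothesis on \<open>f\<close> to
  points of the hyperplane at which another gradient will be known not to vanish.\<close>

lemma reciprocal_p_poly_dvd:
  fixes P f :: "complex ^ ('m::finite) option \<Rightarrow> complex"
  assumes n: "n \<ge> 1" and P: "is_reciprocal (n ^ (CARD('m) - 1)) (p_poly n) P"
    and f: "polynomial_fun f"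
    and 0: "\<And>y. y \<in> torus \<Longrightarrow> root_form (\<lambda>_. 1) y = 0 \<Longrightarrow> 
      (\<And>s. s \<in> S \<Longrightarrow> root_form s y \<noteq> 0) \<Longrightarrow> f (vinverse (vpow n y)) = 0"
    and S: "finite S" "(\<lambda>_. 1) \<notin> S"
  shows "\<exists>g. polynomial_fun g \<and> f = (\<lambda>x. P x * g x)"
proof -
  let ?d = "n ^ (CARD('m) - 1)"
  let ?\<Pi> = "\<lambda>x :: complex ^ 'm option. \<Prod>i\<in>UNIV. x $ i"
  have reverse: "\<exists>e g. polynomial_fun g \<and> (\<forall>x\<in>torus. g x = ?\<Pi> x ^ e * f (vinverse x))"
    if poly: "polynomial_fun f" for f :: "complex ^ 'm option \<Rightarrow> complex"
  proof -
    obtain e where "has_exponents {a. \<forall>i. a i \<le> e} f"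
      using polynomial_fun_bounded_exponents[OF poly] by blast
    from has_exponents_reverse[OF this, of e] show ?thesis
      by (auto dest: has_exponents_imp_polynomial_fun)
  qed
  obtain e g where g: "polynomial_fun g" "\<And>x. x \<in> torus \<Longrightarrow> g x = ?\<Pi> x ^ e * f (vinverse x)"
    using reverse[OF f] by blast
  have "g x = 0" if x: "p_poly n x = 0" for x
  proof -
    obtain y where y: "vpow n y = x" "root_form (\<lambda>_. 1) y = 0"
      using p_poly_zero_root[OF n x] by blast
    have "g (vpow n y) = 0"
    proof (rule root_form_generic[OF _ S y(2)])
      show "polynomial_fun (\<lambda>y. g (vpow n y))"
        unfolding vpow_def by (intro polynomial_fun_subst[OF g(1)] polynomial_fun_intros)
      fix y :: "complex ^ 'm option"
      assume y: "root_form (\<lambda>_. 1) y = 0" "y \<in> torus" "\<And>s. s \<in> S \<Longrightarrow> root_form s y \<noteq> 0"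
      have "vpow n y \<in> torus"
        using y(2) by (simp add: torus_def)
      with 0[OF y(2,1,3)] g(2) show "g (vpow n y) = 0" by simp
    qed simp
    with y(1) show ?thesis by simp
  qed
  from p_poly_dvd[OF n g(1) this] obtain k where
    k: "polynomial_fun k" "g = (\<lambda>x. p_poly n x * k x)" by blast
  obtain e' k' where k': "polynomial_fun k'" "\<And>x. x \<in> torus \<Longrightarrow> k' x = ?\<Pi> x ^ e' * k (vinverse x)"
    using reverse[OF k(1)] by blast
  have Ppoly: "polynomial_fun P"
    using P by (simp add: is_reciprocal_def)
  have "(\<lambda>x. ?\<Pi> x ^ (?d + e') * f x) = (\<lambda>x. P x * (?\<Pi> x ^ e * k' x))"
  proof (rule polynomial_fun_eqI_torus)
    fix x :: "complex ^ 'm option" assume x: "x \<in> torus"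
    have "inverse (?\<Pi> x) ^ e * f x = p_poly n (vinverse x) * k (vinverse x)"
      using g(2)[of "vinverse x"] fun_cong[OF k(2), of "vinverse x"] x by (simp add: prod_vinverse)
    then have "f x = ?\<Pi> x ^ e * (p_poly n (vinverse x) * k (vinverse x))"
      using prod_torus_nonzero[OF x] by (simp add: field_simps)
    then show "?\<Pi> x ^ (?d + e') * f x = P x * (?\<Pi> x ^ e * k' x)"
      using P x k'(2)[OF x] by (simp add: is_reciprocal_def power_add)
  qed (intro polynomial_fun_intros f Ppoly k')+
  then have "?\<Pi> x ^ (?d + e') * f x = P x * (?\<Pi> x ^ e * k' x)" for x
    by meson
  moreover have "polynomial_fun (\<lambda>x. ?\<Pi> x ^ e * k' x)"
    by (intro polynomial_fun_intros k')
  ultimately obtain h where "polynomial_fun h" "\<And>x. f x = P x * h x"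
    using coordinate_powers_cancel[OF f Ppoly _ reciprocal_p_poly_coordinate[OF n P]] by blast
  then show ?thesis
    by blast
qed

text \<open>On the torus \<open>g\<close> is \<open>c p\<^sub>n\<close> times a Laurent monomial. If some coordinate had a positive exponent
  in it, then that coordinate would divide \<open>g\<close>; if some exponent were negative, then that
  coordinate would divide \<open>p\<^sub>n\<close>.\<close>

lemma mobius_transform_reciprocal_p_poly:
  fixes P g :: "complex ^ ('m::finite) option \<Rightarrow> complex"
  assumes n: "n \<ge> 1" and P: "is_reciprocal (n ^ (CARD('m) - 1)) (p_poly n) P" and c: "c \<noteq> 0"
  shows "mobius_transform (\<lambda>x. c * P x) g \<longleftrightarrow> g = (\<lambda>x. c * p_poly n x)"
proof
  let ?d = "n ^ (CARD('m) - 1)"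
  have Pinv: "P (vinverse x) = inverse (\<Prod>i\<in>UNIV. x $ i) ^ ?d * p_poly n x" if "x \<in> torus" for x
    using P that by (simp add: is_reciprocal_def prod_vinverse)
  have not_zero: "\<exists>x. x $ i = 0 \<and> p_poly n x \<noteq> 0" for i :: "'m option"
  proof -
    obtain j where "j \<noteq> i" by (metis option.distinct(1))
    then show ?thesis
      using p_poly_axis[OF n, of j] by (intro exI[of _ "axis j 1"]) (simp add: axis_def)
  qed
  {
    assume g: "g = (\<lambda>x. c * p_poly n x)"
    show "mobius_transform (\<lambda>x. c * P x) g"
      unfolding mobius_transform_def
    proof (intro conjI exI[of _ "\<lambda>_. ?d"] ballI allI notI)
      show "polynomial_fun g"
        unfolding g by (intro polynomial_fun_intros polynomial_fun_p_poly n)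
      fix x :: "complex ^ 'm option" assume x: "x \<in> torus"
      show "g x = (\<Prod>i\<in>UNIV. x $ i ^ ?d) * (c * P (vinverse x))"
        unfolding Pinv[OF x] g prod_power_distrib[symmetric]
        using prod_torus_nonzero[OF x] by (simp add: power_inverse)
    next
      fix i assume "\<exists>h. polynomial_fun h \<and> g = (\<lambda>x. x $ i * h x)"
      then obtain h where "g = (\<lambda>x. x $ i * h x)" by blast
      moreover obtain x where "x $ i = 0" "p_poly n x \<noteq> 0"
        using not_zero by blast
      ultimately show False
        using fun_cong[OF g, of x] c by simp
    qed
  }
  assume m: "mobius_transform (\<lambda>x. c * P x) g"
  then obtain e where g: "polynomial_fun g" and
    e: "\<And>x. x \<in> torus \<Longrightarrow> g x = (\<Prod>i\<in>UNIV. x $ i ^ e i) * (c * P (vinverse x))" and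
    nd: "\<And>i h. polynomial_fun h \<Longrightarrow> g \<noteq> (\<lambda>x. x $ i * h x)"
    unfolding mobius_transform_def by blast
  let ?A = "\<lambda>x :: complex ^ 'm option. \<Prod>i\<in>UNIV. x $ i ^ (?d - e i)"
  let ?B = "\<lambda>x :: complex ^ 'm option. \<Prod>i\<in>UNIV. x $ i ^ (e i - ?d)"
  have "(\<lambda>x. ?A x * g x) = (\<lambda>x. ?B x * (c * p_poly n x))"
  proof (rule polynomial_fun_eqI_torus)
    fix x :: "complex ^ 'm option" assume x: "x \<in> torus"
    have "x $ i ^ (?d - e i) * (x $ i ^ e i * inverse (x $ i) ^ ?d) = x $ i ^ (e i - ?d)" for i
    proof (cases "e i \<le> ?d")
      case True
      then obtain k where "?d = e i + k" using le_Suc_ex by blast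
      then show ?thesis using x by (simp add: torus_def power_add field_simps)
    next
      case False
      then obtain k where "e i = ?d + k" by (metis le_Suc_ex nat_le_linear)
      then show ?thesis using x by (simp add: torus_def power_add field_simps)
    qed
    then have "?A x * ((\<Prod>i\<in>UNIV. x $ i ^ e i) * (\<Prod>i\<in>UNIV. inverse (x $ i) ^ ?d)) = ?B x"
      by (simp only: prod.distrib[symmetric])
    moreover have "(\<Prod>i\<in>UNIV. inverse (x $ i) ^ ?d) = inverse (\<Prod>i\<in>UNIV. x $ i) ^ ?d"
      by (simp only: prod_power_distrib[symmetric] prod_vinverse[unfolded vinverse_def vec_lambda_beta])
    ultimately show "?A x * g x = ?B x * (c * p_poly n x)"
      unfolding e[OF x] Pinv[OF x] by (simp only: mult_ac)
  qed (intro polynomial_fun_intros g polynomial_fun_p_poly n)+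
  then have eq: "?A x * g x = ?B x * (c * p_poly n x)" for x
    by meson
  have "e i = ?d" for i
  proof (rule linorder_cases[of "e i" ?d])
    assume less: "e i < ?d"
    obtain x where x: "x $ i = 0" "p_poly n x \<noteq> 0"
      using not_zero by blast
    let ?a = "(\<chi> j. if j = i then 0 else 1) :: complex ^ 'm option"
    have "c * p_poly n x = 0"
    proof (rule coordinate_cancel[of ?B _ ?a i])
      show "?B ?a \<noteq> 0" using less by auto
      fix x :: "complex ^ 'm option" assume "x $ i = 0"
      then have "?A x = 0" using less by auto
      with eq[of x] show "?B x * (c * p_poly n x) = 0" by (metis mult_zero_left)
    qed (intro polynomial_fun_intros polynomial_fun_p_poly n | simp add: x)+
    with x c show ?thesis by simp
  next
    assume less: "?d < e i"
    let ?a = "(\<chi> j. if j = i then 0 else 1) :: complex ^ 'm option"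
    have "g x = 0" if "x $ i = 0" for x
    proof (rule coordinate_cancel[of ?A g ?a i])
      show "?A ?a \<noteq> 0" using less by auto
      fix x :: "complex ^ 'm option" assume "x $ i = 0"
      then have "?B x = 0" using less by auto
      with eq[of x] show "?A x * g x = 0" by (metis mult_zero_left)
    qed (intro polynomial_fun_intros g | simp add: that)+
    then show ?thesis
      using coordinate_factor[OF g] nd by blast
  qed
  with eq show "g = (\<lambda>x. c * p_poly n x)" by (simp add: fun_eq_iff)
qed

section \<open>The dual variety and the shift\<close>

lemma defining_polynomial_X_var:
  assumes "n \<ge> 1"
  shows "defining_polynomial (X_var n :: ('m::finite) option cproj set) (p_poly n)"
proof -
  let ?p = "p_poly n :: complex ^ 'm option \<Rightarrow> complex"
  have "vanishing_forms (zero_locus ?p) =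
      {f. form f \<and> (\<exists>g. polynomial_fun g \<and> f = (\<lambda>x. ?p x * g x))}"
  proof (intro set_eqI iffI)
    fix f assume "f \<in> vanishing_forms (zero_locus ?p)"
    then have f: "form f" "\<And>v. v \<noteq> 0 \<Longrightarrow> ?p v = 0 \<Longrightarrow> f v = 0"
      using mem_zero_locus[OF form_p_poly[OF assms]] by (auto simp: vanishing_forms_def)
    with p_poly_dvd[OF assms form_polynomial_fun[OF f(1)]]
    show "f \<in> {f. form f \<and> (\<exists>g. polynomial_fun g \<and> f = (\<lambda>x. ?p x * g x))}"
      by (auto dest: torus_nonzero)
  qed (auto simp: vanishing_forms_def mem_zero_locus[OF form_p_poly[OF assms]])
  then show ?thesis
    by (simp add: defining_polynomial_def X_var_def form_p_poly[OF assms])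
qed

text \<open>The claim is polynomial in the point, and the points of \<open>X\<^sub>n\<close> are parametrized by a hyperplane.
  So it suffices to consider the general point \<open>y\<^sup>n\<close>, where the gradient is proportional to the
  inverse of the point \<open>y\<^sup>n\<^sup>-\<^sup>1\<close> of \<open>X\<^sub>n\<^sub>-\<^sub>1\<close>. In particular, no smooth point outside the torus contributes
  anything new to the dual variety.\<close>

lemma reciprocal_vanishes_on_gradient:
  fixes P :: "complex ^ ('m::finite) option \<Rightarrow> complex"
  assumes n: "n \<ge> 2" and D: "is_gradient (p_poly n) D"
    and P: "is_reciprocal ((n - 1) ^ (CARD('m) - 1)) (p_poly (n - 1)) P" "form P"
    and x: "p_poly n x = 0"
  shows "P (\<chi> i. D i x) = 0"
proof -
  have n1: "n \<ge> 1" "n - 1 \<ge> 1" using n by auto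
  obtain y where y: "vpow n y = x" "root_form (\<lambda>_. 1) y = 0"
    using p_poly_zero_root[OF n1(1) x] by blast
  have Dpoly: "polynomial_fun (D i)" for i
    using D by (simp add: is_gradient_def)
  have "P (\<chi> i. D i (vpow n y)) = 0"
  proof (rule root_form_generic[OF _ _ _ y(2), of _ "unity_tuples n - {\<lambda>_. 1}"])
    have "polynomial_fun (\<lambda>y. D i (vpow n y))" for i
      unfolding vpow_def by (intro polynomial_fun_subst[OF Dpoly] polynomial_fun_intros)
    then show "polynomial_fun (\<lambda>y. P (\<chi> i. D i (vpow n y)))"
      by (intro polynomial_fun_subst[OF form_polynomial_fun[OF P(2)]])
    fix y :: "complex ^ 'm option"
    assume y: "root_form (\<lambda>_. 1) y = 0" "y \<in> torus"
      "\<And>s. s \<in> unity_tuples n - {\<lambda>_. 1} \<Longrightarrow> root_form s y \<noteq> 0"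
    have "vpow (n - 1) y \<in> torus"
      using y(2) by (simp add: torus_def)
    then have "P (vinverse (vpow (n - 1) y)) = 0"
      using P(1) p_poly_vpow_eq_0[OF n1(2) one_in_unity_tuples y(1)]
      by (simp add: is_reciprocal_def)
    then show "P (\<chi> i. D i (vpow n y)) = 0"
      using p_poly_gradient_generic[OF n1(1) D y] form_scale_zero[OF P(2)] by auto
  qed (use unity_tuples_finite_card(1)[OF n1(1), where 'm = 'm] in auto)
  with y(1) show ?thesis by simp
qed

text \<open>Both inclusions of ideals are on record: the general points \<open>y\<^sup>n\<close> are smooth and have enough
  tangent hyperplanes to force divisibility by \<open>P\<close>, and \<open>P\<close> vanishes at the gradient at any point.\<close>

lemma dual_variety_X_var:
  fixes P :: "complex ^ ('m::finite) option \<Rightarrow> complex"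
  assumes n: "n \<ge> 2"
    and P: "is_reciprocal ((n - 1) ^ (CARD('m) - 1)) (p_poly (n - 1)) P" "form P"
  shows "dual_variety (X_var n) = zero_locus P" and "defining_polynomial (dual_variety (X_var n)) P"
proof -
  have n1: "n \<ge> 1" "n - 1 \<ge> 1" using n by auto
  let ?X = "X_var n :: 'm option cproj set"
  note X = defining_polynomial_X_var[OF n1(1), where 'm = 'm]
  obtain D where D: "is_gradient (p_poly n :: complex ^ 'm option \<Rightarrow> complex) D"
    using polynomial_fun_has_gradient[OF polynomial_fun_p_poly[OF n1(1)]] by blast
  let ?tangent = "\<lambda>u. \<exists>x. smooth_at ?X x \<and> tangent_space ?X x \<subseteq> hyperplane u"
  have S: "{abs_cproj u | u. u \<noteq> 0 \<and> ?tangent u} = {abs_cproj (id u) | u. ?tangent u \<and> id u \<noteq> 0}"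
    by auto
  have on_X: "abs_cproj x \<in> ?X \<longleftrightarrow> p_poly n x = 0" if "x \<noteq> 0" for x
    unfolding X_var_def using mem_zero_locus[OF form_p_poly[OF n1(1)] that] .
  have "vanishing_forms {abs_cproj u | u. u \<noteq> 0 \<and> ?tangent u} =
      {f. form f \<and> (\<exists>g. polynomial_fun g \<and> f = (\<lambda>x. P x * g x))}"
    unfolding S vanishing_forms_points
  proof (intro Collect_cong conj_cong refl iffI)
    fix f :: "complex ^ 'm option \<Rightarrow> complex"
    assume f: "form f" and 0: "\<forall>u. ?tangent u \<longrightarrow> id u \<noteq> 0 \<longrightarrow> f (id u) = 0"
    show "\<exists>g. polynomial_fun g \<and> f = (\<lambda>x. P x * g x)"
    proof (rule reciprocal_p_poly_dvd[OF n1(2) P(1) form_polynomial_fun[OF f]])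
      fix y :: "complex ^ 'm option"
      assume y: "y \<in> torus" "root_form (\<lambda>_. 1) y = 0"
        "\<And>s. s \<in> unity_tuples n - {\<lambda>_. 1} \<Longrightarrow> root_form s y \<noteq> 0"
      let ?u = "vinverse (vpow (n - 1) y)" and ?x = "vpow n y"
      obtain c where c: "c \<noteq> 0" "(\<chi> i. D i ?x) = c *s ?u"
        using p_poly_gradient_generic[OF n1(1) D y(2,1,3)] by blast
      have u: "?u \<noteq> 0" and x: "?x \<noteq> 0"
        using y(1) by (auto intro!: torus_nonzero simp: torus_def vinverse_def)
      have px: "p_poly n ?x = 0"
        by (rule p_poly_vpow_eq_0[OF n1(1) one_in_unity_tuples y(2)])
      have T: "tangent_space ?X ?x = hyperplane (c *s ?u)"
        using tangent_space_hypersurface[OF X D px] c(2) by simp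
      moreover have "vec.dim (hyperplane (c *s ?u)) = CARD('m option) - 1"
        by (rule hyperplane_dim) (use c u in simp)
      ultimately have "smooth_at ?X ?x"
        using x px on_X[OF x] by (simp add: smooth_at_def)
      moreover have "hyperplane (c *s ?u) \<subseteq> hyperplane ?u"
        using c(1) by (auto simp: hyperplane_def scalar_product_def mult.assoc simp flip: sum_distrib_left)
      ultimately have "?tangent ?u"
        using T by auto
      with 0 u show "f ?u = 0" by simp
    qed (use unity_tuples_finite_card(1)[OF n1(1), where 'm = 'm] in auto)
  next
    fix f :: "complex ^ 'm option \<Rightarrow> complex"
    assume "\<exists>g. polynomial_fun g \<and> f = (\<lambda>x. P x * g x)"
    then obtain g where f: "f = (\<lambda>x. P x * g x)" by blast
    show "\<forall>u. ?tangent u \<longrightarrow> id u \<noteq> 0 \<longrightarrow> f (id u) = 0"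
    proof (intro allI impI)
      fix u assume "?tangent u" and u: "id u \<noteq> 0"
      then obtain x where x: "smooth_at ?X x" "tangent_space ?X x \<subseteq> hyperplane u" by blast
      then have px: "p_poly n x = 0"
        using on_X by (auto simp: smooth_at_def)
      have "hyperplane (\<chi> i. D i x) \<subseteq> hyperplane u"
        using x(2) tangent_space_hypersurface[OF X D px] by simp
      from hyperplane_subset_imp_scale[OF this] u obtain c where "u = c *s (\<chi> i. D i x)"
        by auto
      then show "f (id u) = 0"
        using form_scale_zero[OF P(2) reciprocal_vanishes_on_gradient[OF n D P px]] f by simp
    qed
  qed
  from principal_zariski_closure[OF P(2) this]
  show "dual_variety ?X = zero_locus P" and "defining_polynomial (dual_variety ?X) P"
    by (simp_all add: dual_variety_def)
qed

lemma mobius_image_zero_locus_reciprocal: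
  fixes P :: "complex ^ ('m::finite) option \<Rightarrow> complex"
  assumes n: "n \<ge> 1" and P: "is_reciprocal (n ^ (CARD('m) - 1)) (p_poly n) P" "form P"
  shows "mobius_image (zero_locus P) = X_var n"
proof -
  let ?R = "\<lambda>u :: complex ^ 'm option. u \<in> torus \<and> p_poly n (vinverse u) = 0"
  have "{abs_cproj (vinverse u) | u. u \<in> torus \<and> abs_cproj u \<in> zero_locus P} =
      {abs_cproj (vinverse u) | u. ?R u \<and> vinverse u \<noteq> 0}"
  proof -
    have "(u \<in> torus \<and> abs_cproj u \<in> zero_locus P) \<longleftrightarrow> ?R u \<and> vinverse u \<noteq> 0" for u
    proof (cases "u \<in> torus")
      case True
      then show ?thesis
        using P torus_nonzero[of u] torus_nonzero[of "vinverse u"] prod_torus_nonzero[of u]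
        by (simp add: mem_zero_locus is_reciprocal_def)
    qed simp
    then show ?thesis by simp
  qed
  moreover have "vanishing_forms {abs_cproj (vinverse u) | u. ?R u \<and> vinverse u \<noteq> 0} =
      {f. form f \<and> (\<exists>g. polynomial_fun g \<and> f = (\<lambda>x. p_poly n x * g x))}"
    unfolding vanishing_forms_points
  proof (intro Collect_cong conj_cong refl iffI)
    fix f :: "complex ^ 'm option \<Rightarrow> complex"
    assume f: "form f" and 0: "\<forall>u. ?R u \<longrightarrow> vinverse u \<noteq> 0 \<longrightarrow> f (vinverse u) = 0"
    show "\<exists>g. polynomial_fun g \<and> f = (\<lambda>x. p_poly n x * g x)"
    proof (rule p_poly_dvd[OF n form_polynomial_fun[OF f]])
      fix x :: "complex ^ 'm option" assume "x \<in> torus" "p_poly n x = 0"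
      then show "f x = 0"
        using 0[rule_format, of "vinverse x"] torus_nonzero[of x] by simp
    qed
  qed auto
  ultimately show ?thesis
    using principal_zariski_closure(1)[OF form_p_poly[OF n]]
    by (simp add: mobius_image_def X_var_def)
qed

lemma multihomogenization_cmult:
  assumes "multihomogenization N f F"
  shows "multihomogenization N (\<lambda>x. c * f x) (\<lambda>y. c * F y)"
proof -
  obtain A k where A: "finite A" "\<forall>a\<in>A. \<forall>i. a i \<le> N" "f = (\<lambda>x. \<Sum>a\<in>A. k a * monomial a x)"
    "F = (\<lambda>y. \<Sum>a\<in>A. k a * (\<Prod>i\<in>UNIV. (y i $ 1) ^ a i * (y i $ 2) ^ (N - a i)))"
    using assms unfolding multihomogenization_def by blast
  then show ?thesis
    unfolding multihomogenization_def
    by (intro exI[of _ A] exI[of _ "\<lambda>a. c * k a"]) (simp add: sum_distrib_left mult.assoc)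
qed

text \<open>A nonzero factor changes only the leading coefficient of the binary form, not its zeros.\<close>

lemma algebraic_operation_cmult:
  assumes "c \<noteq> 0"
  shows "algebraic_operation N (\<lambda>x. c * f x) = algebraic_operation N f"
proof -
  have imp: "algebraic_operation N (\<lambda>x. c * f x) xs M"
    if op: "algebraic_operation N f xs M" and c: "c \<noteq> 0" for c f xs M
  proof -
    obtain F ys rs d where F: "multihomogenization N f F"
      "\<forall>j. ys j \<noteq> 0 \<and> xs j = abs_cproj (ys j)" "length rs = N" "\<forall>r\<in>set rs. r \<noteq> 0" "d \<noteq> 0"
      "\<forall>\<zeta>. F (case_option \<zeta> ys) = d * (\<Prod>r\<leftarrow>rs. \<zeta> $ 1 * r $ 2 - \<zeta> $ 2 * r $ 1)"
      "M = mset (map abs_cproj rs)"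
      using op unfolding algebraic_operation_def by blast
    with multihomogenization_cmult[OF F(1), of c] c show ?thesis
      unfolding algebraic_operation_def
      by (intro exI[of _ "\<lambda>y. c * F y"] exI[of _ ys] exI[of _ rs] exI[of _ "c * d"]) simp
  qed
  show ?thesis
  proof (intro ext iffI)
    fix xs M
    show "algebraic_operation N f xs M" if "algebraic_operation N (\<lambda>x. c * f x) xs M"
      using imp[OF that, of "inverse c"] assms by (simp flip: mult.assoc)
  qed (use imp assms in blast)
qed

theorem theorem11:
  fixes n :: nat
  assumes "n \<ge> 2" and "CARD('m :: finite) \<ge> 2"
  shows
    "(\<exists>!g :: complex ^ 'm option \<Rightarrow> complex.
        is_reciprocal ((n - 1) ^ (CARD('m) - 1)) (p_poly (n - 1)) g) \<and>
     dual_variety (X_var n :: 'm option cproj set) = zero_locus (P_poly n) \<and>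
     defining_polynomial (X_var n :: 'm option cproj set) (p_poly n) \<and>
     defining_polynomial (X_var (n - 1) :: 'm option cproj set) (p_poly (n - 1)) \<and>
     defining_polynomial (dual_variety (X_var n :: 'm option cproj set)) (P_poly n) \<and>
     mobius_image (dual_variety (X_var n :: 'm option cproj set)) = X_var (n - 1) \<and>
     (\<forall>g :: complex ^ 'm option \<Rightarrow> complex.
        duality_shift (p_poly n) g \<longleftrightarrow> (\<exists>c. c \<noteq> 0 \<and> g = (\<lambda>x. c * p_poly (n - 1) x))) \<and>
     (\<forall>g :: complex ^ 'm option \<Rightarrow> complex. duality_shift (p_poly n) g \<longrightarrow>
        algebraic_operation ((n - 1) ^ (CARD('m) - 1)) g = O_operation (n - 1))"
proof -
  let ?d = "(n - 1) ^ (CARD('m) - 1)"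
  let ?p = "p_poly (n - 1) :: complex ^ 'm option \<Rightarrow> complex"
  have n: "n \<ge> 1" "n - 1 \<ge> 1" using assms(1) by auto
  obtain P where P: "is_reciprocal ?d ?p P" "form P"
    using form_reciprocal_exists[OF p_poly_form_of_degree[OF n(2)]] by blast
  have PP: "P_poly n = P"
    unfolding P_poly_def by (rule is_reciprocal_reciprocal[OF P(1)])
  note dual = dual_variety_X_var[OF assms(1) P]
  obtain a where a: "P a \<noteq> 0"
    using reciprocal_p_poly_coordinate[OF n(2) P(1)] by blast
  have shift: "duality_shift (p_poly n) g \<longleftrightarrow> (\<exists>c. c \<noteq> 0 \<and> g = (\<lambda>x. c * ?p x))" for g
  proof
    assume "duality_shift (p_poly n) g"
    then obtain q where q: "defining_polynomial (dual_variety (X_var n :: 'm option cproj set)) q"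
      "mobius_transform q g"
      unfolding duality_shift_def X_var_def by blast
    obtain c where "c \<noteq> 0" "q = (\<lambda>x. c * P x)"
      using defining_polynomial_unique[OF q(1) dual(2) a] by blast
    with q(2) mobius_transform_reciprocal_p_poly[OF n(2) P(1)]
    show "\<exists>c. c \<noteq> 0 \<and> g = (\<lambda>x. c * ?p x)" by blast
  next
    assume "\<exists>c. c \<noteq> 0 \<and> g = (\<lambda>x. c * ?p x)"
    then obtain c where c: "c \<noteq> 0" "g = (\<lambda>x. c * ?p x)" by blast
    then show "duality_shift (p_poly n) g"
      using mobius_transform_reciprocal_p_poly[OF n(2) P(1) c(1)] defining_polynomial_cmult[OF dual(2) c(1)]
      unfolding duality_shift_def X_var_def by blast
  qed
  have "algebraic_operation ?d g = O_operation (n - 1)" if "duality_shift (p_poly n) g"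
    for g :: "complex ^ 'm option \<Rightarrow> complex"
    using that unfolding shift O_operation_def by (auto simp: algebraic_operation_cmult)
  with shift dual PP P(1) is_reciprocal_unique defining_polynomial_X_var n
    mobius_image_zero_locus_reciprocal[OF n(2) P]
  show ?thesis by auto
qed

end
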